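(* Let $G$ be a finite simple graph with at least one edge. (i) If $\chi(G)=\omega(G)$, then $\widehat\alpha(I(G))=\frac{\chi(G)}{\chi(G)-1}$. In particular, this equality holds for all perfect graphs. (ii) If $G$ is $k$-partite, then $\widehat\alpha(I(G))\ge\frac{k}{k-1}$. In particular, if $G$ is a complete $k$-partite graph, then $\widehat\alpha(I(G))=\frac{k}{k-1}$. (iii) If $G$ is bipartite, then $\widehat\alpha(I(G))=2$. (iv) If $G=C_{2n+1}$ is an odd cycle, then $\widehat\alpha(I(C_{2n+1}))=\frac{2n+1}{n+1}$. (v) If $G=C_{2n+1}^c$, then $\widehat\alpha(I(G))=\frac{2n+1}{2n-1}$.
   Context: Let $\mathbb K$ be an algebraically closed field of any characteristic. For a finite simple graph $G=(V,E)$ with $V=\{x_1,\ldots,x_N\}$, the edge ideal is $I(G)=\langle x_ix_j\mid\{x_i,x_j\}\in E\rangle\subseteq R=\mathbb K[x_1,\ldots,x_N]$. $\chi(G)$ is the chromatic number (smallest number of colours in a colouring of $V$ with adjacent vertices receiving different colours) and $\omega(G)$ the clique number (size of a largest set of pairwise adjacent vertices). For $A\subseteq V$ the induced subgraph is $G_A=(A,\{e\in E\mid e\subseteq A\})$; $G$ is perfect if $\omega(G_A)=\chi(G_A)$ for all $A\subseteq V$. $G$ is $k$-partite if there is a partition $V=V_1\cup\cdots\cup V_k$ such that no edge is contained in any $V_i$; bipartite means $2$-partite; a complete $k$-partite graph has such a partition and its edges are all $\{v_i,v_j\}$ with $v_i\in V_i$, $v_j\in V_j$, $i\ne j$. $C_m$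 is the cycle on $m\ge 3$ vertices. $G^c$ is the complement of $G$: same vertex set, with edges the pairs of distinct vertices that are not edges of $G$. For a nonzero homogeneous ideal $J\subseteq R$: $\alpha(J)=\min\{d\mid J_d\neq 0\}$ is the smallest degree of a nonzero element of $J$; the $m$-th symbolic power is $J^{(m)}=\bigcap_{P\in \mathrm{Ass}(J)}(J^mR_P\cap R)$; the Waldschmidt constant is $\widehat\alpha(J)=\lim_{m\to\infty}\alpha(J^{(m)})/m$ (the limit exists). *)

theory Defs
  imports
    "HOL-Library.Poly_Mapping"
    "HOL-Library.Ramsey"
    "HOL-Library.Disjoint_Sets"
    "HOL-Computational_Algebra.Fraction_Field"
    "HOL-Algebra.Ideal_Product"
    "HOL-Algebra.Algebraic_Closure_Type"
    Complex_Main
begin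

section \<open>Finite simple graphs\<close>

text \<open>A graph is given by its vertex set \<open>V\<close> and its set \<open>E\<close> of two-element subsets of \<open>V\<close>.\<close>

definition simple_graph :: "'v set \<Rightarrow> 'v set set \<Rightarrow> bool" where
  "simple_graph V E \<longleftrightarrow> finite V \<and> E \<subseteq> [V]\<^bsup>2\<^esup>"

definition induced_edges :: "'v set set \<Rightarrow> 'v set \<Rightarrow> 'v set set" where
  "induced_edges E A = {e \<in> E. e \<subseteq> A}"

definition complement_edges :: "'v set \<Rightarrow> 'v set set \<Rightarrow> 'v set set" where
  "complement_edges V E = [V]\<^bsup>2\<^esup> - E"

definition colouring :: "'v set \<Rightarrow> 'v set set \<Rightarrow> nat \<Rightarrow> ('v \<Rightarrow> nat) \<Rightarrow> bool" where
  "colouring V E k c \<longleftrightarrow> c ` V \<subseteq> {..<k} \<and> (\<forall>u\<in>V. \<forall>v\<in>V. {u, v} \<in> E \<longrightarrow> c u \<noteq> c v)"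

definition chromatic_number :: "'v set \<Rightarrow> 'v set set \<Rightarrow> nat" where
  "chromatic_number V E = (LEAST k. \<exists>c. colouring V E k c)"

definition clique_number :: "'v set \<Rightarrow> 'v set set \<Rightarrow> nat" where
  "clique_number V E = Max (card ` {A. A \<subseteq> V \<and> clique A E})"

definition perfect_graph :: "'v set \<Rightarrow> 'v set set \<Rightarrow> bool" where
  "perfect_graph V E \<longleftrightarrow>
     (\<forall>A\<subseteq>V. clique_number A (induced_edges E A) = chromatic_number A (induced_edges E A))"

text \<open>Partitions are in the sense of \<^const>\<open>partition_on\<close>, so all parts are nonempty.  For complete
  \<open>k\<close>-partite graphs this matters: with empty parts allowed, \<open>k\<close> would not be determined
  by the graph.\<close>

definition multipartition :: "'v set \<Rightarrow> 'v set set \<Rightarrow> nat \<Rightarrow> 'v set set \<Rightarrow> bool" where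
  "multipartition V E k P \<longleftrightarrow>
     partition_on V P \<and> card P = k \<and> (\<forall>A\<in>P. \<forall>e\<in>E. \<not> e \<subseteq> A)"

definition k_partite :: "nat \<Rightarrow> 'v set \<Rightarrow> 'v set set \<Rightarrow> bool" where
  "k_partite k V E \<longleftrightarrow> (\<exists>P. multipartition V E k P)"

definition complete_k_partite :: "nat \<Rightarrow> 'v set \<Rightarrow> 'v set set \<Rightarrow> bool" where
  "complete_k_partite k V E \<longleftrightarrow>
     (\<exists>P. multipartition V E k P \<and>
          E = {{u, v} | u v. \<exists>A\<in>P. \<exists>B\<in>P. A \<noteq> B \<and> u \<in> A \<and> v \<in> B})"

abbreviation bipartite :: "'v set \<Rightarrow> 'v set set \<Rightarrow> bool" where
  "bipartite V E \<equiv> k_partite 2 V E"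

definition cycle_graph :: "nat \<Rightarrow> 'v set \<Rightarrow> 'v set set \<Rightarrow> bool" where
  "cycle_graph m V E \<longleftrightarrow>
     3 \<le> m \<and> (\<exists>f. bij_betw f {..<m} V \<and> E = {{f i, f (Suc i mod m)} | i. i < m})"

definition cycle_complement_graph :: "nat \<Rightarrow> 'v set \<Rightarrow> 'v set set \<Rightarrow> bool" where
  "cycle_complement_graph m V E \<longleftrightarrow>
     (\<exists>F. cycle_graph m V F \<and> E = complement_edges V F)"


section \<open>Polynomial rings and edge ideals\<close>

text \<open>A polynomial is a finitely supported map from monomials to coefficients, a monomial being
  a finitely supported map from variables to exponents.  The variables form a linearly ordered
  type because \<^theory>\<open>HOL-Library.Poly_Mapping\<close> provides the integral domain instance, needed
  for fractions, only in that case.\<close>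

type_synonym ('v, 'k) mpoly = "('v \<Rightarrow>\<^sub>0 nat) \<Rightarrow>\<^sub>0 'k"

definition var :: "'v \<Rightarrow> ('v, 'k::zero_neq_one) mpoly" where
  "var x = Poly_Mapping.single (Poly_Mapping.single x 1) 1"

definition mpoly_ring :: "'v::linorder set \<Rightarrow> ('v, 'k::field) mpoly ring" where
  "mpoly_ring V = ring_of_type_algebra
     \<lparr>carrier := {f. \<forall>t\<in>Poly_Mapping.keys f. Poly_Mapping.keys t \<subseteq> V}\<rparr>"

definition edge_ideal :: "'v::linorder set \<Rightarrow> 'v set set \<Rightarrow> ('v, 'k::field) mpoly set" where
  "edge_ideal V E = Idl\<^bsub>mpoly_ring V\<^esub> {var x * var y | x y. {x, y} \<in> E}"

definition total_degree :: "('v \<Rightarrow>\<^sub>0 nat) \<Rightarrow> nat" where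
  "total_degree t = (\<Sum>x\<in>Poly_Mapping.keys t. Poly_Mapping.lookup t x)"

definition homogeneous_component :: "('v, 'k::zero) mpoly set \<Rightarrow> nat \<Rightarrow> ('v, 'k) mpoly set" where
  "homogeneous_component J d = {f \<in> J. \<forall>t\<in>Poly_Mapping.keys f. total_degree t = d}"

definition initial_degree :: "('v, 'k::zero) mpoly set \<Rightarrow> nat" where
  "initial_degree J = (LEAST d. homogeneous_component J d \<noteq> {0})"


section \<open>Symbolic powers and the Waldschmidt constant\<close>

text \<open>The associated primes of \<open>R/J\<close>: the prime ideals of the form \<open>(J : f)\<close>.\<close>

definition associated_primes :: "('a, 'b) ring_scheme \<Rightarrow> 'a set \<Rightarrow> 'a set set" where
  "associated_primes R J =
     {P. primeideal P R \<and> (\<exists>f\<in>carrier R. P = {r \<in> carrier R. r \<otimes>\<^bsub>R\<^esub> f \<in> J})}"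

definition ideal_power :: "('a, 'b) ring_scheme \<Rightarrow> 'a set \<Rightarrow> nat \<Rightarrow> 'a set" where
  "ideal_power R J m = J [^]\<^bsub>ideals_set R\<^esub> m"

text \<open>In the following, \<open>R\<close> is a subring of (the ring structure on) an integral domain type, so its
  localization at a prime \<open>P\<close> is the ring of fractions with denominator outside \<open>P\<close>.\<close>

definition localization :: "'a::idom ring \<Rightarrow> 'a set \<Rightarrow> 'a fract ring" where
  "localization R P = ring_of_type_algebra
     \<lparr>carrier := {Fraction_Field.Fract a s | a s. a \<in> carrier R \<and> s \<in> carrier R - P}\<rparr>"

definition extended_ideal :: "'a::idom ring \<Rightarrow> 'a set \<Rightarrow> 'a set \<Rightarrow> 'a fract set" where
  "extended_ideal R P J = Idl\<^bsub>localization R P\<^esub> ((\<lambda>f. Fraction_Field.Fract f 1) ` J)"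

definition symbolic_power :: "'a::idom ring \<Rightarrow> 'a set \<Rightarrow> nat \<Rightarrow> 'a set" where
  "symbolic_power R J m =
     (\<Inter>P\<in>associated_primes R J.
        {f \<in> carrier R. Fraction_Field.Fract f 1 \<in> extended_ideal R P (ideal_power R J m)})"

definition waldschmidt ::
    "('v::linorder, 'k::field) mpoly ring \<Rightarrow> ('v, 'k) mpoly set \<Rightarrow> real" where
  "waldschmidt R J = lim (\<lambda>m. real (initial_degree (symbolic_power R J m)) / real m)"

end

theory Submission
  imports Defs
begin

text \<open>A monomial \<open>x\<^sup>t\<close> lies in the \<open>m\<close>-th symbolic power of the edge ideal iff \<open>t\<close> has weight at
  least \<open>m\<close> on every vertex cover, so \<open>\<alpha>(I\<^sup>(\<^sup>m\<^sup>))\<close> is the least total weight of such a \<open>t\<close>. This is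
  subadditive in \<open>m\<close>, and the Waldschmidt constant is the value of the corresponding linear program,
  which is bounded on both sides by explicit feasible points. If \<open>N\<close> independent sets are such that
  each vertex is missed by at most \<open>b\<close> of them, averaging over their complements gives the lower
  bound \<open>N / b\<close>; if every vertex cover meets \<open>S\<close> in at least \<open>c\<close> vertices, the indicator of \<open>S\<close>
  gives the upper bound \<open>|S| / c\<close>. The two agree for colour classes and a clique, for the rotations
  of a maximum independent set of an odd cycle with all vertices, and for the edges of the cycle
  with all vertices of its complement.\<close>

section \<open>Subrings of a type\<close>

lemma cring_type_subset:
  fixes A :: "'a::comm_ring_1 set"
  assumes "1 \<in> A" "\<And>x. x \<in> A \<Longrightarrow> - x \<in> A"
    "\<And>x y. x \<in> A \<Longrightarrow> y \<in> A \<Longrightarrow> x + y \<in> A" "\<And>x y. x \<in> A \<Longrightarrow> y \<in> A \<Longrightarrow> x * y \<in> A"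
  shows "cring (ring_of_type_algebra\<lparr>carrier := A\<rparr>)"
proof -
  have "0 \<in> A"
    using assms(3)[OF assms(1) assms(2)[OF assms(1)]] by simp
  moreover have "\<exists>y\<in>A. x + y = 0" if "x \<in> A" for x
    using assms(2)[OF that] by (intro bexI[of _ "- x"]) auto
  ultimately show ?thesis
    using assms unfolding ring_of_type_algebra_def
    by unfold_locales (auto simp: algebra_simps Units_def intro: add.commute)
qed

text \<open>Additive inverses in \<open>I\<close> come from multiplication by \<open>- 1\<close>,
  which is why \<open>- 1\<close> has to lie in \<open>A\<close>.\<close>

lemma ideal_type_subsetI:
  fixes A :: "'a::comm_ring_1 set"
  assumes cr: "cring (ring_of_type_algebra\<lparr>carrier := A\<rparr>)"
    and m1: "- 1 \<in> A" and sub: "I \<subseteq> A" and z: "0 \<in> I"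
    and add: "\<And>x y. x \<in> I \<Longrightarrow> y \<in> I \<Longrightarrow> x + y \<in> I"
    and mul: "\<And>x y. x \<in> A \<Longrightarrow> y \<in> I \<Longrightarrow> x * y \<in> I"
  shows "ideal I (ring_of_type_algebra\<lparr>carrier := A\<rparr>)"
proof -
  let ?R = "ring_of_type_algebra\<lparr>carrier := A\<rparr>"
  interpret cring ?R by (rule cr)
  have neg: "- x \<in> I" if "x \<in> I" for x
    using mul[OF m1 that] by simp
  \<comment> \<open>The inverse chosen by the ring record is unary minus of the type, by uniqueness
    of additive inverses.\<close>
  have a_inv: "\<ominus>\<^bsub>?R\<^esub> x = - x" if "x \<in> I" for x
    using that sub neg[OF that]
    by (intro sum_zero_eq_neg[symmetric]) (auto simp: ring_of_type_algebra_def)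
  show ?thesis
  proof (rule idealI)
    show "subgroup I (add_monoid ?R)"
    proof
      show "inv\<^bsub>add_monoid ?R\<^esub> x \<in> I" if "x \<in> I" for x
        using a_inv[OF that] neg[OF that] by (simp add: a_inv_def)
    qed (use sub z add in \<open>auto simp: ring_of_type_algebra_def\<close>)
  next
    fix a x assume "a \<in> I" "x \<in> carrier ?R"
    then show "x \<otimes>\<^bsub>?R\<^esub> a \<in> I" "a \<otimes>\<^bsub>?R\<^esub> x \<in> I"
      using mul[of x a] by (auto simp: ring_of_type_algebra_def mult.commute[of a x])
  qed (rule ring_axioms)
qed

lemma ideal_type_subsetD:
  assumes "ideal I (ring_of_type_algebra\<lparr>carrier := A\<rparr>)"
  shows "I \<subseteq> A" "0 \<in> I" "x \<in> I \<Longrightarrow> y \<in> I \<Longrightarrow> x + y \<in> I" "a \<in> A \<Longrightarrow> x \<in> I \<Longrightarrow> a * x \<in> I"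
proof -
  interpret ideal I "ring_of_type_algebra\<lparr>carrier := A\<rparr>" by (rule assms)
  show "I \<subseteq> A" "0 \<in> I" "x \<in> I \<Longrightarrow> y \<in> I \<Longrightarrow> x + y \<in> I" "a \<in> A \<Longrightarrow> x \<in> I \<Longrightarrow> a * x \<in> I"
    using a_subset additive_subgroup.zero_closed[OF ideal.axioms(1)[OF assms]]
      additive_subgroup.a_closed[OF ideal.axioms(1)[OF assms], of x y] I_l_closed[of x a]
    by (simp_all add: ring_of_type_algebra_def)
qed

lemma ideal_power_ideal:
  assumes "ring R" "ideal J R"
  shows "ideal (ideal_power R J m) R"
proof -
  interpret ring R by (rule assms)
  show ?thesis
    by (induction m)
      (auto simp: ideal_power_def nat_pow_def ideals_set_def
         intro: oneideal ideal_prod_is_ideal assms(2))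
qed

lemma ideal_power_0: "ideal_power R J 0 = carrier R"
  and ideal_power_Suc: "ideal_power R J (Suc m) = ideal_prod R (ideal_power R J m) J"
  by (simp_all add: ideal_power_def nat_pow_def ideals_set_def)


section \<open>Localizations\<close>

text \<open>Clearing denominators gives one direction, multiplying by the fraction
  \<open>1 / s\<close> the other. Later arguments use this pair to pass between symbolic and
  ordinary powers.\<close>

lemma
  fixes A :: "'a::idom set"
  assumes A: "1 \<in> A" "\<And>x. x \<in> A \<Longrightarrow> - x \<in> A"
    "\<And>x y. x \<in> A \<Longrightarrow> y \<in> A \<Longrightarrow> x + y \<in> A" "\<And>x y. x \<in> A \<Longrightarrow> y \<in> A \<Longrightarrow> x * y \<in> A"
    and R: "R = ring_of_type_algebra\<lparr>carrier := A\<rparr>"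
    and P: "primeideal P R" and J: "ideal J R"
  shows extended_ideal_denominator:
      "Fraction_Field.Fract f 1 \<in> extended_ideal R P J \<Longrightarrow> \<exists>s\<in>A - P. s * f \<in> J"
    and extended_ideal_memI:
      "s \<in> A - P \<Longrightarrow> s * f \<in> J \<Longrightarrow> Fraction_Field.Fract f 1 \<in> extended_ideal R P J"
proof -
  interpret P: primeideal P R by (rule P)
  note JD = ideal_type_subsetD[OF J[unfolded R]]
  have zP: "0 \<in> P"
    using ideal_type_subsetD(2)[OF P.is_ideal[unfolded R]] .
  have one: "1 \<in> A - P"
    using P.one_imp_carrier P.I_notcarr A(1) by (auto simp: R ring_of_type_algebra_def)
  have mulP: "s * t \<in> A - P" if "s \<in> A - P" "t \<in> A - P" for s t
    using that P.I_prime[of s t] A(4)[of s t] by (auto simp: R ring_of_type_algebra_def)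
  have nz: "s \<noteq> 0" if "s \<in> A - P" for s
    using that zP by auto
  define L where "L = {Fraction_Field.Fract a s | a s. a \<in> A \<and> s \<in> A - P}"
  have LR: "localization R P = ring_of_type_algebra\<lparr>carrier := L\<rparr>"
    by (simp add: localization_def L_def R)
  have L1: "1 \<in> L" "- 1 \<in> L"
  proof -
    have "1 = Fraction_Field.Fract (1::'a) 1" "- 1 = Fraction_Field.Fract (- 1 :: 'a) 1"
      by (simp_all add: fract_collapse flip: minus_fract)
    then show "1 \<in> L" "- 1 \<in> L"
      using one A(1) A(2)[OF A(1)] unfolding L_def by blast+
  qed
  have ringL: "cring (ring_of_type_algebra\<lparr>carrier := L\<rparr>)"
  proof (rule cring_type_subset)
    show "- x \<in> L" if x: "x \<in> L" for x
    proof -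
      obtain a s where "x = Fraction_Field.Fract a s" "a \<in> A" "s \<in> A - P"
        using x by (auto simp: L_def)
      then show ?thesis
        using A(2) by (auto simp: L_def)
    qed
    fix x y assume "x \<in> L" "y \<in> L"
    then obtain a s b t where x: "x = Fraction_Field.Fract a s" "a \<in> A" "s \<in> A - P"
      and y: "y = Fraction_Field.Fract b t" "b \<in> A" "t \<in> A - P"
      by (auto simp: L_def)
    have "x + y = Fraction_Field.Fract (a * t + b * s) (s * t)"
      using x y nz by (simp add: mult.commute)
    moreover have "a * t + b * s \<in> A"
      using x y A by auto
    ultimately show "x + y \<in> L"
      using mulP[OF x(3) y(3)] unfolding L_def by blast
    have "x * y = Fraction_Field.Fract (a * b) (s * t)"
      using x y by simp
    then show "x * y \<in> L"
      using mulP[OF x(3) y(3)] A(4)[OF x(2) y(2)] unfolding L_def by blast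
  qed (rule L1)
  \<comment> \<open>The expected explicit form of the extended ideal. As an ideal containing the
    image of \<open>J\<close>, it contains the generated one, so every member has a numerator in
    \<open>J\<close>.\<close>
  define K where "K = {Fraction_Field.Fract a s | a s. a \<in> J \<and> s \<in> A - P}"
  have "ideal K (ring_of_type_algebra\<lparr>carrier := L\<rparr>)"
  proof (rule ideal_type_subsetI[OF ringL L1(2)])
    show "K \<subseteq> L" unfolding K_def L_def using JD(1) by blast
    show "0 \<in> K" unfolding K_def using JD(2) one Zero_fract_def by blast
  next
    fix x y assume "x \<in> K" "y \<in> K"
    then obtain a s b t where x: "x = Fraction_Field.Fract a s" "a \<in> J" "s \<in> A - P"
      and y: "y = Fraction_Field.Fract b t" "b \<in> J" "t \<in> A - P"
      by (auto simp: K_def)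
    have "x + y = Fraction_Field.Fract (t * a + s * b) (s * t)"
      using x y nz by (simp add: mult.commute)
    moreover have "t * a + s * b \<in> J"
      using x y JD(3,4) by auto
    ultimately show "x + y \<in> K"
      using mulP[OF x(3) y(3)] unfolding K_def by blast
  next
    fix x y assume "x \<in> L" "y \<in> K"
    then obtain a s b t where x: "x = Fraction_Field.Fract a s" "a \<in> A" "s \<in> A - P"
      and y: "y = Fraction_Field.Fract b t" "b \<in> J" "t \<in> A - P"
      by (auto simp: K_def L_def)
    have "x * y = Fraction_Field.Fract (a * b) (s * t)"
      using x y by simp
    then show "x * y \<in> K"
      using mulP[OF x(3) y(3)] JD(4)[OF x(2) y(2)] unfolding K_def by blast
  qed
  moreover have "(\<lambda>f. Fraction_Field.Fract f 1) ` J \<subseteq> K"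
    unfolding K_def using one by blast
  ultimately have EK: "extended_ideal R P J \<subseteq> K"
    unfolding extended_ideal_def LR genideal_def by blast
  show "\<exists>s\<in>A - P. s * f \<in> J" if f: "Fraction_Field.Fract f 1 \<in> extended_ideal R P J"
  proof -
    obtain a s where as: "Fraction_Field.Fract f 1 = Fraction_Field.Fract a s" "a \<in> J" "s \<in> A - P"
      using f EK by (auto simp: K_def)
    then have "s * f = a"
      using nz[OF as(3)] by (simp add: eq_fract mult.commute)
    then show ?thesis using as by blast
  qed
  show "Fraction_Field.Fract f 1 \<in> extended_ideal R P J" if s: "s \<in> A - P" "s * f \<in> J"
    unfolding extended_ideal_def LR genideal_def
  proof (clarify)
    fix Q assume Q: "ideal Q (ring_of_type_algebra\<lparr>carrier := L\<rparr>)"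
      and sub: "(\<lambda>f. Fraction_Field.Fract f 1) ` J \<subseteq> Q"
    have "Fraction_Field.Fract 1 s \<in> L"
      using s(1) A(1) unfolding L_def by blast
    then have "Fraction_Field.Fract 1 s * Fraction_Field.Fract (s * f) 1 \<in> Q"
      using sub s(2) by (intro ideal_type_subsetD(4)[OF Q]) auto
    also have "Fraction_Field.Fract 1 s * Fraction_Field.Fract (s * f) 1 = Fraction_Field.Fract f 1"
      using nz[OF s(1)] by (simp add: eq_fract)
    finally show "Fraction_Field.Fract f 1 \<in> Q" .
  qed
qed

section \<open>Weighted degrees and monomials\<close>

definition weight :: "'v set \<Rightarrow> ('v \<Rightarrow>\<^sub>0 nat) \<Rightarrow> nat" where
  "weight C t = (\<Sum>x\<in>C. Poly_Mapping.lookup t x)"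

lemma weight_add: "weight C (s + t) = weight C s + weight C t"
  by (simp add: weight_def lookup_add sum.distrib)

lemma weight_single: "finite C \<Longrightarrow> weight C (Poly_Mapping.single x n) = (if x \<in> C then n else 0)"
  by (simp add: weight_def lookup_single when_def)

lemma weight_zero: "weight C 0 = 0"
  by (simp add: weight_def)

lemma weight_mono: "finite D \<Longrightarrow> C \<subseteq> D \<Longrightarrow> weight C t \<le> weight D t"
  unfolding weight_def by (rule sum_mono2) auto

lemma total_degree_eq_weight:
  assumes "finite V" "Poly_Mapping.keys t \<subseteq> V"
  shows "total_degree t = weight V t"
  unfolding total_degree_def weight_def
  by (rule sum.mono_neutral_left) (use assms in \<open>auto simp: in_keys_iff\<close>)

lemma keys_add_nat:
  "Poly_Mapping.keys (s + t :: 'v \<Rightarrow>\<^sub>0 nat) = Poly_Mapping.keys s \<union> Poly_Mapping.keys t"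
  by (auto simp: in_keys_iff lookup_add)

lemma poly_mapping_sum_single:
  "(\<Sum>t\<in>Poly_Mapping.keys f. Poly_Mapping.single t (Poly_Mapping.lookup f t)) = f"
  by (rule poly_mapping_eqI) (auto simp: lookup_sum lookup_single when_def in_keys_iff)

text \<open>Shifting by \<open>a\<close> is injective in a cancellative monoid, so at most one term
  of \<open>f\<close> contributes to the coefficient at \<open>a + u\<close>.\<close>

lemma lookup_single_mult:
  fixes f :: "'a::cancel_comm_monoid_add \<Rightarrow>\<^sub>0 'b::comm_semiring_1"
  shows "Poly_Mapping.lookup (Poly_Mapping.single a c * f) (a + u) = c * Poly_Mapping.lookup f u"
proof -
  have "Poly_Mapping.single a c * f
      = Poly_Mapping.single a c * (\<Sum>t\<in>Poly_Mapping.keys f. Poly_Mapping.single t (Poly_Mapping.lookup f t))"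
    by (simp add: poly_mapping_sum_single)
  also have "\<dots> = (\<Sum>t\<in>Poly_Mapping.keys f. Poly_Mapping.single (a + t) (c * Poly_Mapping.lookup f t))"
    by (simp add: sum_distrib_left mult_single)
  finally show ?thesis
    by (auto simp: lookup_sum lookup_single when_def in_keys_iff)
qed

text \<open>For a finite subset \<open>C\<close> of the ring's variables, the members lying in the
  ring form the \<open>m\<close>-th power of the prime generated by the variables in
  \<open>C\<close>.\<close>

definition order_ge :: "'v set \<Rightarrow> nat \<Rightarrow> ('v, 'k::zero) mpoly set" where
  "order_ge C m = {f. \<forall>t\<in>Poly_Mapping.keys f. m \<le> weight C t}"

text \<open>The initial forms with respect to the weight multiply to something nonzero, so a factor
  of order zero does not change the order.\<close>

lemma order_ge_cancel:
  fixes s f :: "('v::linorder, 'k::field) mpoly"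
  assumes sf: "s * f \<in> order_ge C m" and s: "s \<notin> order_ge C 1"
  shows "f \<in> order_ge C m"
proof (rule ccontr)
  assume f: "f \<notin> order_ge C m"
  define j where "j = Min (weight C ` Poly_Mapping.keys f)"
  obtain t' where t': "t' \<in> Poly_Mapping.keys f" "weight C t' < m"
    using f by (auto simp: order_ge_def not_le)
  have jle: "j \<le> weight C t" if "t \<in> Poly_Mapping.keys f" for t
    using that by (auto simp: j_def)
  have jm: "j < m"
    using jle[OF t'(1)] t'(2) by simp
  have "j \<in> weight C ` Poly_Mapping.keys f"
    unfolding j_def using t'(1) by (intro Min_in) auto
  then obtain tf where tf: "tf \<in> Poly_Mapping.keys f" "weight C tf = j"
    by auto
  \<comment> \<open>Weight 0 is the least possible, so the initial form of \<open>s\<close> is its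
    part of weight 0.\<close>
  obtain ts where ts: "ts \<in> Poly_Mapping.keys s" "weight C ts = 0"
    using s by (auto simp: order_ge_def not_le)
  define part where "part = (\<lambda>i (p :: ('v, 'k) mpoly). Poly_Mapping.mapp (\<lambda>t c. c when weight C t = i) p)"
  have lk: "Poly_Mapping.lookup (part i p) t = (if weight C t = i then Poly_Mapping.lookup p t else 0)"
    for i p t
    by (auto simp: part_def lookup_mapp when_def in_keys_iff)
  have part_keys: "Poly_Mapping.keys (part i p) \<subseteq> {t \<in> Poly_Mapping.keys p. weight C t = i}" for i p
    by (auto simp: in_keys_iff lk split: if_splits)
  have rest_keys: "Poly_Mapping.keys (p - part i p) \<subseteq> {t \<in> Poly_Mapping.keys p. weight C t \<noteq> i}" for i p
    by (auto simp: in_keys_iff lk lookup_minus split: if_splits)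
  define s0 where "s0 = part 0 s"
  define f0 where "f0 = part j f"
  have "s0 \<noteq> 0"
    using ts lk[of 0 s ts] by (auto simp: s0_def in_keys_iff)
  moreover have "f0 \<noteq> 0"
    using tf lk[of j f tf] by (auto simp: f0_def in_keys_iff)
  \<comment> \<open>The polynomial type is an integral domain, so the product of the initial forms
    has a monomial \<open>t\<close>, and its weight is exactly \<open>j\<close>.\<close>
  ultimately have "s0 * f0 \<noteq> 0"
    by simp
  then obtain t where t: "t \<in> Poly_Mapping.keys (s0 * f0)"
    by (metis all_not_in_conv keys_eq_empty)
  obtain a b where ab: "t = a + b" "a \<in> Poly_Mapping.keys s0" "b \<in> Poly_Mapping.keys f0"
    using t keys_mult[of s0 f0] by blast
  have wt: "weight C t = j"
    using ab subsetD[OF part_keys, of a 0 s] subsetD[OF part_keys, of b j f]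
    by (simp add: s0_def f0_def weight_add)
  have r1: "t \<notin> Poly_Mapping.keys (s0 * (f - f0))"
  proof
    assume "t \<in> Poly_Mapping.keys (s0 * (f - f0))"
    then obtain a b where ab: "t = a + b" "b \<in> Poly_Mapping.keys (f - f0)" "a \<in> Poly_Mapping.keys s0"
      using keys_mult[of s0 "f - f0"] by blast
    then have "weight C b > j"
      using rest_keys[of f j] jle[of b] by (force simp: f0_def)
    then show False using wt ab(1) by (simp add: weight_add)
  qed
  have r2: "t \<notin> Poly_Mapping.keys ((s - s0) * f)"
  proof
    assume "t \<in> Poly_Mapping.keys ((s - s0) * f)"
    then obtain a b where ab: "t = a + b" "a \<in> Poly_Mapping.keys (s - s0)" "b \<in> Poly_Mapping.keys f"
      using keys_mult[of "s - s0" f] by blast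
    then have "weight C a > 0" "weight C b \<ge> j"
      using rest_keys[of s 0] jle[of b] by (auto simp: s0_def)
    then show False using wt ab(1) by (simp add: weight_add)
  qed
  \<comment> \<open>The last two products only have terms of weight above \<open>j\<close>, so the
    coefficient at \<open>t\<close> comes from \<open>s0 * f0\<close> alone and does not
    cancel.\<close>
  have "s * f = s0 * f0 + s0 * (f - f0) + (s - s0) * f"
    by (simp add: algebra_simps)
  then have "Poly_Mapping.lookup (s * f) t \<noteq> 0"
    using t r1 r2 by (simp add: lookup_add in_keys_iff)
  then have "m \<le> weight C t"
    using sf by (auto simp: order_ge_def in_keys_iff)
  then show False using wt jm by simp
qed

lemma order_ge_add: "f \<in> order_ge C m \<Longrightarrow> g \<in> order_ge C m \<Longrightarrow> f + g \<in> order_ge C m"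
  using keys_add[of f g] by (auto simp: order_ge_def)

lemma order_ge_mult:
  fixes f g :: "('v, 'k::comm_semiring_1) mpoly"
  assumes "f \<in> order_ge C m" "g \<in> order_ge C n"
  shows "f * g \<in> order_ge C (m + n)"
  unfolding order_ge_def
proof (intro CollectI ballI)
  fix t assume "t \<in> Poly_Mapping.keys (f * g)"
  then obtain a b where "t = a + b" "a \<in> Poly_Mapping.keys f" "b \<in> Poly_Mapping.keys g"
    using keys_mult[of f g] by blast
  then show "m + n \<le> weight C t"
    using assms by (auto simp: order_ge_def weight_add add_mono)
qed

section \<open>Polynomials in the variables from a given set\<close>

definition mpoly_carrier :: "'v set \<Rightarrow> ('v, 'k::zero) mpoly set" where
  "mpoly_carrier V = {f. \<forall>t\<in>Poly_Mapping.keys f. Poly_Mapping.keys t \<subseteq> V}"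

lemma mpoly_ring_eq: "mpoly_ring V = ring_of_type_algebra\<lparr>carrier := mpoly_carrier V\<rparr>"
  by (simp add: mpoly_ring_def mpoly_carrier_def)

lemma mpoly_ring_simps:
  "carrier (mpoly_ring V) = mpoly_carrier V"
  "x \<otimes>\<^bsub>mpoly_ring V\<^esub> y = x * y" "x \<oplus>\<^bsub>mpoly_ring V\<^esub> y = x + y"
  by (simp_all add: mpoly_ring_eq ring_of_type_algebra_def)

lemma mpoly_carrier_closed:
  fixes f g :: "('v, 'k::comm_ring_1) mpoly"
  shows "(1 :: ('v, 'k) mpoly) \<in> mpoly_carrier V"
    "f \<in> mpoly_carrier V \<Longrightarrow> - f \<in> mpoly_carrier V"
    "f \<in> mpoly_carrier V \<Longrightarrow> g \<in> mpoly_carrier V \<Longrightarrow> f + g \<in> mpoly_carrier V"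
    "f \<in> mpoly_carrier V \<Longrightarrow> g \<in> mpoly_carrier V \<Longrightarrow> f * g \<in> mpoly_carrier V"
proof -
  show "(1 :: ('v, 'k) mpoly) \<in> mpoly_carrier V"
    by (auto simp: mpoly_carrier_def)
  show "- f \<in> mpoly_carrier V" if "f \<in> mpoly_carrier V"
    using that by (auto simp: mpoly_carrier_def in_keys_iff)
  show "f + g \<in> mpoly_carrier V" if "f \<in> mpoly_carrier V" "g \<in> mpoly_carrier V"
    using that keys_add[of f g] by (auto simp: mpoly_carrier_def)
  show "f * g \<in> mpoly_carrier V" if "f \<in> mpoly_carrier V" "g \<in> mpoly_carrier V"
    unfolding mpoly_carrier_def
  proof (intro CollectI ballI)
    fix t assume "t \<in> Poly_Mapping.keys (f * g)"
    then obtain a b where "t = a + b" "a \<in> Poly_Mapping.keys f" "b \<in> Poly_Mapping.keys g"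
      using keys_mult[of f g] by blast
    then show "Poly_Mapping.keys t \<subseteq> V"
      using that by (auto simp: mpoly_carrier_def keys_add_nat)
  qed
qed

lemma cring_mpoly_ring: "cring (mpoly_ring V :: ('v::linorder, 'k::field) mpoly ring)"
  unfolding mpoly_ring_eq by (intro cring_type_subset mpoly_carrier_closed)

lemma ideal_mpoly_ringI:
  fixes I :: "('v::linorder, 'k::field) mpoly set"
  assumes "I \<subseteq> mpoly_carrier V" "0 \<in> I" "\<And>x y. x \<in> I \<Longrightarrow> y \<in> I \<Longrightarrow> x + y \<in> I"
    "\<And>x y. x \<in> mpoly_carrier V \<Longrightarrow> y \<in> I \<Longrightarrow> x * y \<in> I"
  shows "ideal I (mpoly_ring V)"
  unfolding mpoly_ring_eq
  by (rule ideal_type_subsetI[OF cring_mpoly_ring[unfolded mpoly_ring_eq]])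
    (use assms mpoly_carrier_closed(2)[OF mpoly_carrier_closed(1)] in auto)

lemma ideal_mpoly_ringD:
  fixes I :: "('v::linorder, 'k::field) mpoly set"
  assumes "ideal I (mpoly_ring V)"
  shows "I \<subseteq> mpoly_carrier V" "0 \<in> I" "x \<in> I \<Longrightarrow> y \<in> I \<Longrightarrow> x + y \<in> I"
    "a \<in> mpoly_carrier V \<Longrightarrow> x \<in> I \<Longrightarrow> a * x \<in> I"
  using ideal_type_subsetD[OF assms[unfolded mpoly_ring_eq]] by blast+

lemma ideal_mpoly_ring_sum:
  assumes "ideal I (mpoly_ring V)" "\<And>x. x \<in> T \<Longrightarrow> g x \<in> I"
  shows "sum g T \<in> I"
  using assms(2)
  by (induction T rule: infinite_finite_induct) (auto intro: ideal_mpoly_ringD[OF assms(1)])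

section \<open>The edge ideal and its associated primes\<close>

text \<open>For two-element edges this is divisibility of the monomial by a generator of the edge
  ideal.\<close>

definition supports_edge :: "'v set set \<Rightarrow> ('v \<Rightarrow>\<^sub>0 nat) \<Rightarrow> bool" where
  "supports_edge E t \<longleftrightarrow> (\<exists>e\<in>E. e \<subseteq> Poly_Mapping.keys t)"

lemma simple_graph_edgeE:
  assumes "simple_graph V E" "e \<in> E"
  obtains x y where "e = {x, y}" "x \<noteq> y" "x \<in> V" "y \<in> V"
  using assms unfolding simple_graph_def nsets_2_eq by blast

lemma simple_graph_neighbourE:
  assumes "simple_graph V E" "e \<in> E" "x \<in> e"
  obtains y where "e = {x, y}" "y \<noteq> x" "y \<in> V"
proof -
  obtain a b where "e = {a, b}" "a \<noteq> b" "a \<in> V" "b \<in> V"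
    using simple_graph_edgeE[OF assms(1,2)] .
  then show ?thesis
    using that[of a] that[of b] assms(3) by blast
qed

text \<open>Membership in a monomial ideal is decided term by term: the right-hand side is an ideal
  containing the generators, and every term of a member is a multiple of a generator.\<close>

lemma edge_ideal_eq:
  fixes V :: "'v::linorder set"
  assumes G: "simple_graph V E"
  shows "edge_ideal V E = {f \<in> mpoly_carrier V :: ('v, 'k::field) mpoly set.
    \<forall>t\<in>Poly_Mapping.keys f. supports_edge E t}" (is "_ = ?M")
proof -
  let ?S = "{var x * var y | x y. {x, y} \<in> E} :: ('v, 'k) mpoly set"
  have var2: "(var x * var y :: ('v, 'k) mpoly)
      = Poly_Mapping.single (Poly_Mapping.single x 1 + Poly_Mapping.single y 1) 1" for x y
    by (simp add: var_def mult_single)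
  have "ideal ?M (mpoly_ring V)"
  proof (rule ideal_mpoly_ringI)
    fix f g :: "('v, 'k) mpoly" assume "f \<in> ?M" "g \<in> ?M"
    then show "f + g \<in> ?M"
      using keys_add[of f g] mpoly_carrier_closed(3)[of f V g] by auto
  next
    fix f g :: "('v, 'k) mpoly" assume fg: "f \<in> mpoly_carrier V" "g \<in> ?M"
    have "supports_edge E t" if t: "t \<in> Poly_Mapping.keys (f * g)" for t
    proof -
      obtain a b where ab: "t = a + b" "b \<in> Poly_Mapping.keys g"
        using subsetD[OF keys_mult t] by blast
      then have "supports_edge E b"
        using fg by blast
      then show ?thesis
        unfolding supports_edge_def ab(1) keys_add_nat by blast
    qed
    then show "f * g \<in> ?M"
      using fg mpoly_carrier_closed(4)[of f V g] by auto
  qed (auto simp: mpoly_carrier_def)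
  moreover have "?S \<subseteq> ?M"
  proof
    fix p assume "p \<in> ?S"
    then obtain x y where xy: "{x, y} \<in> E"
      and p: "p = Poly_Mapping.single (Poly_Mapping.single x 1 + Poly_Mapping.single y 1) 1"
      by (auto simp: var2)
    have V: "x \<in> V" "y \<in> V"
      using G xy by (auto simp: simple_graph_def)
    have "supports_edge E (Poly_Mapping.single x 1 + Poly_Mapping.single y 1)"
      unfolding supports_edge_def by (intro bexI[OF _ xy]) (auto simp: keys_add_nat)
    then show "p \<in> ?M"
      using V by (simp add: p mpoly_carrier_def keys_add_nat)
  qed
  ultimately have "edge_ideal V E \<subseteq> ?M"
    unfolding edge_ideal_def genideal_def by blast
  moreover have "?M \<subseteq> edge_ideal V E"
    unfolding edge_ideal_def genideal_def
  proof (intro subsetI InterI)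
    fix f Q assume f: "f \<in> ?M" and Q: "Q \<in> {I. ideal I (mpoly_ring V) \<and> ?S \<subseteq> I}"
    then have idQ: "ideal Q (mpoly_ring V)" and SQ: "?S \<subseteq> Q"
      by auto
    have "Poly_Mapping.single t c \<in> Q" if t: "t \<in> Poly_Mapping.keys f" for t and c :: 'k
    proof -
      obtain e where e: "e \<in> E" "e \<subseteq> Poly_Mapping.keys t"
        using f t by (auto simp: supports_edge_def)
      obtain x y where xy: "e = {x, y}" "x \<noteq> y" "x \<in> V" "y \<in> V"
        using simple_graph_edgeE[OF G e(1)] .
      \<comment> \<open>The quotient of the monomial by \<open>x y\<close>. Truncated subtraction
        loses nothing, since \<open>x\<close> and \<open>y\<close> are distinct and both occur in
        \<open>t\<close>.\<close>
      define u where "u = t - (Poly_Mapping.single x 1 + Poly_Mapping.single y 1)"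
      have "t = u + (Poly_Mapping.single x 1 + Poly_Mapping.single y 1)"
        using e xy
        by (intro poly_mapping_eqI)
          (auto simp: u_def lookup_add lookup_minus lookup_single when_def in_keys_iff)
      then have "Poly_Mapping.single t c = Poly_Mapping.single u c * (var x * var y)"
        unfolding var2 mult_single by simp
      moreover have "Poly_Mapping.single u c \<in> mpoly_carrier V"
      proof -
        have "Poly_Mapping.keys u \<subseteq> Poly_Mapping.keys t"
          by (auto simp: u_def in_keys_iff lookup_minus)
        also have "\<dots> \<subseteq> V"
          using f t by (auto simp: mpoly_carrier_def)
        finally show ?thesis
          by (auto simp: mpoly_carrier_def)
      qed
      moreover have "var x * var y \<in> Q"
        using SQ e xy by auto
      ultimately show ?thesis
        by (simp add: ideal_mpoly_ringD(4)[OF idQ])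
    qed
    then have "(\<Sum>t\<in>Poly_Mapping.keys f. Poly_Mapping.single t (Poly_Mapping.lookup f t)) \<in> Q"
      by (rule ideal_mpoly_ring_sum[OF idQ])
    then show "f \<in> Q"
      by (simp add: poly_mapping_sum_single)
  qed
  ultimately show ?thesis by blast
qed

section \<open>Vertex covers and the associated primes\<close>

definition vertex_cover :: "'v set \<Rightarrow> 'v set set \<Rightarrow> 'v set \<Rightarrow> bool" where
  "vertex_cover V E C \<longleftrightarrow> C \<subseteq> V \<and> (\<forall>e\<in>E. e \<inter> C \<noteq> {})"

lemma vertex_cover_edgeD: "vertex_cover V E C \<Longrightarrow> {x, y} \<in> E \<Longrightarrow> x \<in> C \<or> y \<in> C"
  by (auto simp: vertex_cover_def dest!: bspec[of E _ "{x, y}"])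

text \<open>Deleting \<open>x\<close> from an inclusion-minimal cover uncovers an edge, whose other
  end must lie outside the cover. These outside neighbours are what makes the cover give an
  associated prime.\<close>

lemma minimal_vertex_coverE:
  assumes G: "simple_graph V E" and C: "vertex_cover V E C"
  obtains M where "M \<subseteq> C" "vertex_cover V E M"
    "\<And>x. x \<in> M \<Longrightarrow> \<exists>y. {x, y} \<in> E \<and> y \<notin> M"
proof -
  have "finite C"
    using G C by (auto simp: simple_graph_def vertex_cover_def intro: finite_subset)
  then have fin: "finite {M. M \<subseteq> C \<and> vertex_cover V E M}"
    by simp
  obtain M where M: "M \<subseteq> C" "vertex_cover V E M"
    and min: "\<And>N. N \<subseteq> C \<Longrightarrow> vertex_cover V E N \<Longrightarrow> N \<subseteq> M \<Longrightarrow> M = N"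
  proof -
    have "{M. M \<subseteq> C \<and> vertex_cover V E M} \<noteq> {}"
      using C by auto
    from finite_has_minimal[OF fin this] show ?thesis
      using that by auto
  qed
  have "\<exists>y. {x, y} \<in> E \<and> y \<notin> M" if x: "x \<in> M" for x
  proof -
    have "\<not> vertex_cover V E (M - {x})"
      using min[of "M - {x}"] M(1) x by blast
    then obtain e where e: "e \<in> E" "e \<inter> (M - {x}) = {}"
      using M(2) unfolding vertex_cover_def by blast
    have "e \<inter> M \<noteq> {}"
      using M(2) e(1) unfolding vertex_cover_def by blast
    then have "x \<in> e" using e(2) by blast
    then obtain y where "e = {x, y}" "y \<noteq> x" "y \<in> V"
      by (rule simple_graph_neighbourE[OF G e(1)])
    then show ?thesis using e by blast
  qed
  then show ?thesis using that M by blast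
qed

text \<open>The product of the variables in a finite set \<open>S\<close>. It serves both as a colon
  witness and as a feasible point of the linear program.\<close>

definition indicator_monomial :: "'v set \<Rightarrow> 'v \<Rightarrow>\<^sub>0 nat" where
  "indicator_monomial S = (\<Sum>x\<in>S. Poly_Mapping.single x 1)"

lemma lookup_indicator_monomial:
  "finite S \<Longrightarrow> Poly_Mapping.lookup (indicator_monomial S) x = (if x \<in> S then 1 else 0)"
  by (simp add: indicator_monomial_def lookup_sum lookup_single when_def)

lemma keys_indicator_monomial: "finite S \<Longrightarrow> Poly_Mapping.keys (indicator_monomial S) = S"
  by (auto simp: in_keys_iff lookup_indicator_monomial split: if_splits)

lemma weight_indicator_monomial:
  "finite S \<Longrightarrow> finite C \<Longrightarrow> weight C (indicator_monomial S) = card (C \<inter> S)"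
  by (simp add: weight_def lookup_indicator_monomial sum.If_cases)

lemma weight_pos_iff: "finite C \<Longrightarrow> 1 \<le> weight C t \<longleftrightarrow> C \<inter> Poly_Mapping.keys t \<noteq> {}"
  by (simp add: weight_def Suc_le_eq sum_eq_0_iff flip: neq0_conv) (auto simp: in_keys_iff)

lemma edge_ideal_subset_order_ge:
  assumes G: "simple_graph V E" and C: "vertex_cover V E C"
  shows "edge_ideal V E \<subseteq> order_ge C 1"
proof -
  have fin: "finite C"
    using G C by (auto simp: simple_graph_def vertex_cover_def intro: finite_subset)
  have "1 \<le> weight C t" if "supports_edge E t" for t
    unfolding weight_pos_iff[OF fin]
    using that C unfolding supports_edge_def vertex_cover_def by blast
  then show ?thesis
    unfolding edge_ideal_eq[OF G] order_ge_def by blast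
qed

text \<open>The prime is \<open>(I : f)\<close> for \<open>f\<close> the product of the variables
  outside \<open>C\<close>. As \<open>f\<close> has order 0 along \<open>C\<close>, it cancels from
  members of \<open>I\<close>; conversely each \<open>x\<close> in \<open>C\<close> has a neighbour
  dividing \<open>f\<close>.\<close>

lemma order_ge_associated_prime:
  fixes V :: "'v::linorder set"
  assumes G: "simple_graph V E" and C: "vertex_cover V E C"
    and min: "\<And>x. x \<in> C \<Longrightarrow> \<exists>y. {x, y} \<in> E \<and> y \<notin> C"
  shows "(mpoly_carrier V \<inter> order_ge C 1 :: ('v, 'k::field) mpoly set)
    \<in> associated_primes (mpoly_ring V) (edge_ideal V E)"
proof -
  let ?R = "mpoly_ring V :: ('v, 'k) mpoly ring"
  let ?P = "mpoly_carrier V \<inter> order_ge C 1 :: ('v, 'k) mpoly set"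
  have finV: "finite V" and fin: "finite C"
    using G C by (auto simp: simple_graph_def vertex_cover_def intro: finite_subset)
  have one: "(1 :: ('v, 'k) mpoly) \<notin> order_ge C 1"
    by (simp add: order_ge_def weight_zero)
  have "primeideal ?P ?R"
  proof (rule primeidealI)
    show "ideal ?P ?R"
    proof (rule ideal_mpoly_ringI)
      fix f g :: "('v, 'k) mpoly" assume fg: "f \<in> mpoly_carrier V" "g \<in> ?P"
      have "f \<in> order_ge C 0" by (simp add: order_ge_def)
      then show "f * g \<in> ?P"
        using fg order_ge_mult[of f C 0 g 1] mpoly_carrier_closed(4)[of f V g] by auto
    qed (auto simp: mpoly_carrier_closed order_ge_add, auto simp: order_ge_def mpoly_carrier_def)
    show "cring ?R" by (rule cring_mpoly_ring)
    show "carrier ?R \<noteq> ?P"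
      using one mpoly_carrier_closed(1)[of V, where ?'k = 'k] by (auto simp: mpoly_ring_simps)
    \<comment> \<open>If \<open>a\<close> lies outside the prime, it has order 0 along
      \<open>C\<close> and cancels from the product.\<close>
    show "a \<in> ?P \<or> b \<in> ?P"
      if "a \<in> carrier ?R" "b \<in> carrier ?R" "a \<otimes>\<^bsub>?R\<^esub> b \<in> ?P" for a b
      using that order_ge_cancel[of a b C 1] by (auto simp: mpoly_ring_simps)
  qed
  moreover define f :: "('v, 'k) mpoly"
    where "f = Poly_Mapping.single (indicator_monomial (V - C)) 1"
  have f: "f \<in> mpoly_carrier V" "f \<notin> order_ge C 1"
    using finV fin
    by (auto simp: f_def mpoly_carrier_def order_ge_def keys_indicator_monomial
        weight_indicator_monomial)
  have "r * f \<in> edge_ideal V E \<longleftrightarrow> r \<in> order_ge C 1" if r: "r \<in> mpoly_carrier V" for r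
  proof
    assume "r * f \<in> edge_ideal V E"
    then have "f * r \<in> order_ge C 1"
      using edge_ideal_subset_order_ge[OF G C] by (auto simp: mult.commute)
    then show "r \<in> order_ge C 1"
      using order_ge_cancel f(2) by blast
  next
    assume rC: "r \<in> order_ge C 1"
    have "supports_edge E t" if t: "t \<in> Poly_Mapping.keys (r * f)" for t
    proof -
      obtain a where a: "t = a + indicator_monomial (V - C)" "a \<in> Poly_Mapping.keys r"
        using subsetD[OF keys_mult t] by (auto simp: f_def)
      obtain x where x: "x \<in> C" "x \<in> Poly_Mapping.keys a"
        using rC a(2) weight_pos_iff[OF fin, of a] by (auto simp: order_ge_def)
      obtain y where y: "{x, y} \<in> E" "y \<notin> C"
        using min[OF x(1)] by blast
      have "y \<in> V" using G y by (auto simp: simple_graph_def)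
      then show ?thesis
        using x y a finV unfolding supports_edge_def
        by (intro bexI[of _ "{x, y}"]) (auto simp: keys_add_nat keys_indicator_monomial)
    qed
    then show "r * f \<in> edge_ideal V E"
      using mpoly_carrier_closed(4)[OF r f(1)] by (auto simp: edge_ideal_eq[OF G])
  qed
  then have "?P = {r \<in> carrier ?R. r \<otimes>\<^bsub>?R\<^esub> f \<in> edge_ideal V E}"
    by (auto simp: mpoly_ring_simps)
  ultimately show ?thesis
    unfolding associated_primes_def using f(1) by (auto simp: mpoly_ring_simps)
qed

lemma ideal_edge_ideal:
  fixes V :: "'v::linorder set"
  assumes "simple_graph V E"
  shows "ideal (edge_ideal V E :: ('v, 'k::field) mpoly set) (mpoly_ring V)"
proof -
  interpret cring "mpoly_ring V :: ('v, 'k) mpoly ring" by (rule cring_mpoly_ring)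
  show ?thesis
    unfolding edge_ideal_def
  proof (rule genideal_ideal, clarify)
    fix x y assume "{x, y} \<in> E"
    then have "x \<in> V" "y \<in> V" using assms by (auto simp: simple_graph_def)
    then show "(var x * var y :: ('v, 'k) mpoly) \<in> carrier (mpoly_ring V)"
      unfolding mpoly_ring_simps
      by (intro mpoly_carrier_closed(4)) (auto simp: mpoly_carrier_def var_def)
  qed
qed

lemma ideal_power_subset_order_ge:
  fixes V :: "'v::linorder set"
  assumes G: "simple_graph V E" and C: "vertex_cover V E C"
  shows "ideal_power (mpoly_ring V) (edge_ideal V E :: ('v, 'k::field) mpoly set) m \<subseteq> order_ge C m"
proof (induction m)
  case 0
  then show ?case by (auto simp: order_ge_def)
next
  case (Suc m)
  show ?case
  proof
    fix f assume "f \<in> ideal_power (mpoly_ring V) (edge_ideal V E :: ('v, 'k) mpoly set) (Suc m)"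
    then show "f \<in> order_ge C (Suc m)"
      unfolding ideal_power_Suc
    \<comment> \<open>Induction over the generation of the product ideal: a product adds the orders
      \<open>m\<close> and 1, a sum keeps the bound.\<close>
    proof induction
      case (prod i j)
      then show ?case
        using order_ge_mult[of i C m j 1] Suc edge_ideal_subset_order_ge[OF G C]
        by (auto simp: mpoly_ring_simps)
    qed (auto simp: mpoly_ring_simps order_ge_add)
  qed
qed

text \<open>A prime of the form \<open>(I : f)\<close> need not be identified: if \<open>u\<close> is a monomial of \<open>f\<close> outside
  \<open>I\<close>, every variable in the prime has a neighbour in the support of \<open>u\<close>, and that neighbour
  is invertible after localization.\<close>

lemma associated_prime_monomial_multiple:
  fixes V :: "'v::linorder set" and P :: "('v, 'k::field) mpoly set"
  assumes G: "simple_graph V E"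
    and P: "P \<in> associated_primes (mpoly_ring V) (edge_ideal V E)"
  obtains C where "vertex_cover V E C"
    "\<And>m t. Poly_Mapping.keys t \<subseteq> V \<Longrightarrow> m \<le> weight C t \<Longrightarrow>
      \<exists>s\<in>mpoly_carrier V - P.
        s * Poly_Mapping.single t 1 \<in> ideal_power (mpoly_ring V) (edge_ideal V E) m"
proof -
  let ?R = "mpoly_ring V :: ('v, 'k) mpoly ring"
  let ?I = "edge_ideal V E :: ('v, 'k) mpoly set"
  obtain f where f: "f \<in> mpoly_carrier V" "P = {r \<in> mpoly_carrier V. r * f \<in> ?I}"
    using P by (auto simp: associated_primes_def mpoly_ring_simps)
  interpret P: primeideal P ?R
    using P by (auto simp: associated_primes_def)
  note ID = ideal_mpoly_ringD[OF ideal_edge_ideal[OF G, where ?'k = 'k]]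
  have one: "1 \<in> mpoly_carrier V - P"
    using P.one_imp_carrier P.I_notcarr mpoly_carrier_closed(1)[of V, where ?'k = 'k]
    by (auto simp: mpoly_ring_eq ring_of_type_algebra_def)
  have mulP: "s * t \<in> mpoly_carrier V - P" if "s \<in> mpoly_carrier V - P" "t \<in> mpoly_carrier V - P" for s t
    using that P.I_prime[of s t] mpoly_carrier_closed(4)[of s V t] by (auto simp: mpoly_ring_simps)
  have varV: "var x \<in> mpoly_carrier V" if "x \<in> V" for x
    using that by (simp add: var_def mpoly_carrier_def)
  \<comment> \<open>As \<open>P\<close> is proper, 1 lies outside it, which says that
    \<open>f\<close> is not in the edge ideal.\<close>
  have "f \<notin> ?I"
    using f one by auto
  then obtain u where u: "u \<in> Poly_Mapping.keys f" "\<not> supports_edge E u"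
    using f(1) by (auto simp: edge_ideal_eq[OF G])
  define C where "C = {x \<in> V. var x \<in> P}"
  \<comment> \<open>Multiplication by a variable shifts terms without cancellation, so the monomial
    \<open>x u\<close> really occurs in a member of the edge ideal.\<close>
  have key: "supports_edge E (Poly_Mapping.single x 1 + u)" if "x \<in> C" for x
  proof -
    have "Poly_Mapping.lookup (var x * f) (Poly_Mapping.single x 1 + u) \<noteq> 0"
      using u(1) by (simp add: var_def lookup_single_mult in_keys_iff)
    then have "Poly_Mapping.single x 1 + u \<in> Poly_Mapping.keys (var x * f)"
      by (simp add: in_keys_iff)
    moreover have "var x * f \<in> ?I"
      using that f(2) by (auto simp: C_def)
    ultimately show ?thesis
      by (auto simp: edge_ideal_eq[OF G])
  qed
  have nb: "\<exists>y\<in>V - C. {x, y} \<in> E" if x: "x \<in> C" for x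
  proof -
    obtain e where e: "e \<in> E" "e \<subseteq> insert x (Poly_Mapping.keys u)"
      using key[OF x] by (auto simp: supports_edge_def keys_add_nat)
    have "\<not> e \<subseteq> Poly_Mapping.keys u"
      using u(2) e(1) by (auto simp: supports_edge_def)
    then have "x \<in> e" using e(2) by auto
    then obtain y where y: "e = {x, y}" "y \<noteq> x" "y \<in> V"
      by (rule simple_graph_neighbourE[OF G e(1)])
    have yu: "y \<in> Poly_Mapping.keys u" using e y by auto
    \<comment> \<open>For \<open>y\<close> in \<open>C\<close> the monomial \<open>y u\<close> would
      support an edge; since \<open>y\<close> already divides \<open>u\<close>, so would
      \<open>u\<close>.\<close>
    have "y \<notin> C"
      using key[of y] u(2) yu by (auto simp: supports_edge_def keys_add_nat insert_absorb)
    then show ?thesis using y e by blast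
  qed
  have "vertex_cover V E C"
    unfolding vertex_cover_def
  proof (intro conjI ballI)
    fix e assume e: "e \<in> E"
    obtain x y where xy: "e = {x, y}" "x \<noteq> y" "x \<in> V" "y \<in> V"
      using simple_graph_edgeE[OF G e] .
    \<comment> \<open>An edge product multiplies \<open>f\<close> into the ideal, hence lies in
      \<open>P\<close>; primality then puts one of its variables into \<open>P\<close>.\<close>
    have "(var x * var y :: ('v, 'k) mpoly) \<in> ?I"
      unfolding edge_ideal_def genideal_def using e xy by blast
    then have "f * (var x * var y) \<in> ?I"
      using ID(4) f(1) by blast
    then have "var x * var y \<in> P"
      using f(2) mpoly_carrier_closed(4)[OF varV varV] xy by (auto simp: mult.commute)
    then have "var x \<in> P \<or> var y \<in> P"
      using mulP varV xy by blast
    then show "e \<inter> C \<noteq> {}"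
      using xy by (auto simp: C_def)
  qed (auto simp: C_def)
  moreover have "\<exists>s\<in>mpoly_carrier V - P. s * Poly_Mapping.single t 1 \<in> ideal_power ?R ?I m"
    if "Poly_Mapping.keys t \<subseteq> V" "m \<le> weight C t" for m t
    using that
  proof (induction m arbitrary: t)
    case 0
    have "1 * Poly_Mapping.single t 1 \<in> (mpoly_carrier V :: ('v, 'k) mpoly set)"
      using 0 by (simp add: mpoly_carrier_def)
    then show ?case
      using one unfolding ideal_power_0 mpoly_ring_simps by blast
  next
    case (Suc m)
    have finC: "finite C"
      using G by (auto simp: C_def simple_graph_def)
    obtain x where x: "x \<in> C" "x \<in> Poly_Mapping.keys t"
      using Suc.prems(2) weight_pos_iff[OF finC, of t] by auto
    obtain y where y: "y \<in> V - C" "{x, y} \<in> E"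
      using nb[OF x(1)] by blast
    \<comment> \<open>One variable \<open>x\<close> of \<open>C\<close> is split off. Its neighbour
      \<open>y\<close> outside \<open>C\<close> completes a generator \<open>x y\<close> and is
      absorbed into the denominator.\<close>
    define t' where "t' = t - Poly_Mapping.single x 1"
    have t: "t = t' + Poly_Mapping.single x 1"
      using x(2) by (intro poly_mapping_eqI)
        (auto simp: t'_def lookup_add lookup_minus lookup_single when_def in_keys_iff)
    have "Poly_Mapping.keys t' \<subseteq> V" "m \<le> weight C t'"
      using Suc.prems x(1) finC by (auto simp: t keys_add_nat weight_add weight_single)
    then obtain s where s: "s \<in> mpoly_carrier V - P"
      "s * Poly_Mapping.single t' 1 \<in> ideal_power ?R ?I m"
      using Suc.IH by blast
    have "var x * var y \<in> ?I"
      unfolding edge_ideal_def genideal_def using y by blast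
    then have "(s * Poly_Mapping.single t' 1) \<otimes>\<^bsub>?R\<^esub> (var x * var y) \<in> ideal_power ?R ?I (Suc m)"
      unfolding ideal_power_Suc using s(2) by (intro ideal_prod.prod)
    moreover have "(s * Poly_Mapping.single t' 1) \<otimes>\<^bsub>?R\<^esub> (var x * var y)
        = (s * var y) * Poly_Mapping.single t 1"
    proof -
      have "Poly_Mapping.single t 1 = Poly_Mapping.single t' 1 * (var x :: ('v, 'k) mpoly)"
        by (simp add: t var_def mult_single)
      then show ?thesis by (simp add: mpoly_ring_simps mult_ac)
    qed
    moreover have "s * var y \<in> mpoly_carrier V - P"
      using y(1) varV[of y] by (intro mulP[OF s(1)]) (auto simp: C_def)
    ultimately show ?case by metis
  qed
  ultimately show ?thesis using that by blast
qed


section \<open>The initial degree of a symbolic power\<close>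

text \<open>The integer feasible points of the linear program with right-hand side \<open>m\<close>.
  In a simple graph every cover contains a minimal one, so minimal covers impose the same
  condition.\<close>

definition covering_exponent :: "'v set \<Rightarrow> 'v set set \<Rightarrow> nat \<Rightarrow> ('v \<Rightarrow>\<^sub>0 nat) \<Rightarrow> bool" where
  "covering_exponent V E m t \<longleftrightarrow>
     Poly_Mapping.keys t \<subseteq> V \<and> (\<forall>C. vertex_cover V E C \<longrightarrow> m \<le> weight C t)"

text \<open>Without edges the empty set is a cover and no exponent exists for positive
  \<open>m\<close>; the facts about attained values therefore assume an edge.\<close>

definition covering_degree :: "'v set \<Rightarrow> 'v set set \<Rightarrow> nat \<Rightarrow> nat" where
  "covering_degree V E m = (LEAST d. \<exists>t. covering_exponent V E m t \<and> weight V t = d)"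

text \<open>Each associated prime yields a cover, and the weight of \<open>t\<close> on it yields a
  denominator carrying the monomial into the ordinary power.\<close>

lemma monomial_in_symbolic_power:
  fixes V :: "'v::linorder set"
  assumes G: "simple_graph V E" and t: "covering_exponent V E m t"
  shows "(Poly_Mapping.single t 1 :: ('v, 'k::field) mpoly)
    \<in> symbolic_power (mpoly_ring V) (edge_ideal V E) m"
  unfolding symbolic_power_def
proof (intro INT_I CollectI conjI)
  let ?R = "mpoly_ring V :: ('v, 'k) mpoly ring"
  interpret cring ?R by (rule cring_mpoly_ring)
  show "Poly_Mapping.single t 1 \<in> carrier ?R"
    using t by (auto simp: mpoly_ring_simps mpoly_carrier_def covering_exponent_def)
  fix P :: "('v, 'k) mpoly set"
  assume P: "P \<in> associated_primes ?R (edge_ideal V E)"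
  then have "primeideal P ?R" by (auto simp: associated_primes_def)
  moreover have "ideal (ideal_power ?R (edge_ideal V E) m) ?R"
    by (rule ideal_power_ideal[OF ring_axioms ideal_edge_ideal[OF G]])
  moreover obtain s where "s \<in> mpoly_carrier V - P"
    "s * Poly_Mapping.single t 1 \<in> ideal_power ?R (edge_ideal V E) m"
    using associated_prime_monomial_multiple[OF G P] t by (metis covering_exponent_def)
  ultimately show "Fraction_Field.Fract (Poly_Mapping.single t 1) 1
      \<in> extended_ideal ?R P (ideal_power ?R (edge_ideal V E) m)"
    by (intro extended_ideal_memI[OF mpoly_carrier_closed mpoly_ring_eq])
qed

text \<open>Each cover is shrunk to a minimal one, whose prime is associated. A denominator there
  has order 0, so it cancels and \<open>f\<close> inherits the order bound of the ordinary
  power.\<close>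

lemma symbolic_power_covering_exponent:
  fixes V :: "'v::linorder set" and f :: "('v, 'k::field) mpoly"
  assumes G: "simple_graph V E"
    and f: "f \<in> symbolic_power (mpoly_ring V) (edge_ideal V E) m" and t: "t \<in> Poly_Mapping.keys f"
  shows "covering_exponent V E m t"
proof -
  let ?R = "mpoly_ring V :: ('v, 'k) mpoly ring"
  interpret cring ?R by (rule cring_mpoly_ring)
  have *: "f \<in> mpoly_carrier V \<and> m \<le> weight C t" if C: "vertex_cover V E C" for C
  proof -
    obtain M where M: "M \<subseteq> C" "vertex_cover V E M" "\<And>x. x \<in> M \<Longrightarrow> \<exists>y. {x, y} \<in> E \<and> y \<notin> M"
      using minimal_vertex_coverE[OF G C] by metis
    let ?P = "mpoly_carrier V \<inter> order_ge M 1 :: ('v, 'k) mpoly set"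
    have P: "?P \<in> associated_primes ?R (edge_ideal V E)"
      by (rule order_ge_associated_prime[OF G M(2,3)])
    then have pr: "primeideal ?P ?R" by (auto simp: associated_primes_def)
    have fV: "f \<in> mpoly_carrier V"
      and fe: "Fraction_Field.Fract f 1 \<in> extended_ideal ?R ?P (ideal_power ?R (edge_ideal V E) m)"
      using f P by (auto simp: symbolic_power_def mpoly_ring_simps)
    have "ideal (ideal_power ?R (edge_ideal V E) m) ?R"
      by (rule ideal_power_ideal[OF ring_axioms ideal_edge_ideal[OF G]])
    from extended_ideal_denominator[OF _ _ _ _ mpoly_ring_eq pr this fe]
    have "\<exists>s\<in>mpoly_carrier V - ?P. s * f \<in> ideal_power ?R (edge_ideal V E) m"
      by (simp add: mpoly_carrier_closed)
    then obtain s where s: "s \<in> mpoly_carrier V - ?P" "s * f \<in> ideal_power ?R (edge_ideal V E) m"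
      by (elim bexE)
    have "s * f \<in> order_ge M m"
      using ideal_power_subset_order_ge[OF G M(2)] s(2) by (rule subsetD)
    moreover have "s \<notin> order_ge M 1"
      using s(1) by blast
    ultimately have "f \<in> order_ge M m"
      by (rule order_ge_cancel)
    then have "m \<le> weight M t"
      using t by (auto simp: order_ge_def)
    also have "\<dots> \<le> weight C t"
      using G C M(1) by (intro weight_mono)
        (auto simp: simple_graph_def vertex_cover_def intro: finite_subset)
    finally show ?thesis using fV by simp
  qed
  \<comment> \<open>A cover must be exhibited before \<open>*\<close> can give that \<open>f\<close>
    lies in the ring.\<close>
  have "vertex_cover V E V"
    using G by (auto simp: vertex_cover_def elim!: simple_graph_edgeE)
  then have "f \<in> mpoly_carrier V" using * by blast
  then show ?thesis
    using * t by (auto simp: covering_exponent_def mpoly_carrier_def)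
qed

text \<open>Any term of a nonzero homogeneous member is a covering exponent, and any covering
  exponent is itself a monomial member.\<close>

lemma initial_degree_symbolic_power:
  fixes V :: "'v::linorder set"
  assumes G: "simple_graph V E"
  shows "initial_degree (symbolic_power (mpoly_ring V) (edge_ideal V E :: ('v, 'k::field) mpoly set) m)
    = covering_degree V E m"
proof -
  let ?J = "symbolic_power (mpoly_ring V) (edge_ideal V E :: ('v, 'k) mpoly set) m"
  have finV: "finite V" using G by (simp add: simple_graph_def)
  \<comment> \<open>Only with 0 in the ideal does a component different from \<open>{0}\<close> mean
    one with a nonzero member.\<close>
  have "0 \<in> ?J"
    unfolding symbolic_power_def
  proof (intro INT_I CollectI conjI)
    interpret cring "mpoly_ring V :: ('v, 'k) mpoly ring" by (rule cring_mpoly_ring)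
    show "(0 :: ('v, 'k) mpoly) \<in> carrier (mpoly_ring V)"
      by (simp add: mpoly_ring_simps mpoly_carrier_def)
    fix P :: "('v, 'k) mpoly set"
    assume P: "P \<in> associated_primes (mpoly_ring V) (edge_ideal V E)"
    show "Fraction_Field.Fract 0 1 \<in> extended_ideal (mpoly_ring V) P
        (ideal_power (mpoly_ring V) (edge_ideal V E) m)"
      unfolding extended_ideal_def genideal_def localization_def
      by (auto simp flip: Zero_fract_def dest: ideal_type_subsetD(2))
  qed
  then have "homogeneous_component ?J d \<noteq> {0} \<longleftrightarrow>
      (\<exists>f\<in>?J. f \<noteq> 0 \<and> (\<forall>t\<in>Poly_Mapping.keys f. total_degree t = d))" for d
    by (auto simp: homogeneous_component_def)
  moreover have "(\<exists>f\<in>?J. f \<noteq> 0 \<and> (\<forall>t\<in>Poly_Mapping.keys f. total_degree t = d)) \<longleftrightarrow>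
      (\<exists>t. covering_exponent V E m t \<and> weight V t = d)" for d
  proof
    assume "\<exists>f\<in>?J. f \<noteq> 0 \<and> (\<forall>t\<in>Poly_Mapping.keys f. total_degree t = d)"
    then obtain f where f: "f \<in> ?J" "f \<noteq> 0" "\<And>t. t \<in> Poly_Mapping.keys f \<Longrightarrow> total_degree t = d"
      by blast
    then obtain t where t: "t \<in> Poly_Mapping.keys f"
      by (metis all_not_in_conv keys_eq_empty)
    then have "covering_exponent V E m t"
      using symbolic_power_covering_exponent[OF G f(1)] by blast
    then show "\<exists>t. covering_exponent V E m t \<and> weight V t = d"
      using f(3)[OF t] total_degree_eq_weight[OF finV, of t] by (auto simp: covering_exponent_def)
  next
    assume "\<exists>t. covering_exponent V E m t \<and> weight V t = d"
    then obtain t where t: "covering_exponent V E m t" "weight V t = d" by blast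
    moreover have "total_degree t = d"
      using t total_degree_eq_weight[OF finV, of t] by (auto simp: covering_exponent_def)
    ultimately show "\<exists>f\<in>?J. f \<noteq> 0 \<and> (\<forall>t\<in>Poly_Mapping.keys f. total_degree t = d)"
      using monomial_in_symbolic_power[OF G t(1), where ?'k = 'k]
      by (intro bexI[of _ "Poly_Mapping.single t 1"]) (auto simp flip: keys_eq_empty)
  qed
  ultimately show ?thesis
    by (simp add: initial_degree_def covering_degree_def)
qed


section \<open>The Waldschmidt constant as a fractional covering number\<close>

text \<open>Fekete's lemma: the quotients converge to their infimum.\<close>

lemma subadditive_limit:
  fixes a :: "nat \<Rightarrow> nat"
  assumes sub: "\<And>m n. a (m + n) \<le> a m + a n"
  obtains L where "(\<lambda>n. real (a n) / real n) \<longlonglongrightarrow> L" "\<And>k. 1 \<le> k \<Longrightarrow> L \<le> real (a k) / real k"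
proof -
  \<comment> \<open>The index 0 is left out: its quotient is 0 by the convention for division by
    zero and would force the infimum to be 0.\<close>
  define Q where "Q = (\<lambda>k. real (a k) / real k) ` {1..}"
  define L where "L = Inf Q"
  have bdd: "bdd_below Q"
    unfolding Q_def by (rule bdd_belowI2[of _ 0]) auto
  have lower: "L \<le> real (a k) / real k" if "1 \<le> k" for k
    unfolding L_def by (rule cInf_lower[OF _ bdd]) (use that in \<open>auto simp: Q_def\<close>)
  have multiple: "a (q * k + r) \<le> q * a k + a r" for q k r
  proof (induction q)
    case (Suc q)
    have "a (Suc q * k + r) = a (k + (q * k + r))" by (simp add: add.assoc)
    also have "\<dots> \<le> a k + a (q * k + r)" by (rule sub)
    finally show ?case using Suc by simp
  qed simp
  have "(\<lambda>n. real (a n) / real n) \<longlonglongrightarrow> L"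
  proof (rule LIMSEQ_I)
    fix e :: real assume e: "0 < e"
    have "Q \<noteq> {}" by (auto simp: Q_def)
    moreover have "Inf Q < L + e / 2" using e by (simp add: L_def)
    ultimately obtain k where k: "1 \<le> k" "real (a k) / real k < L + e / 2"
      using cInf_lessD[of Q "L + e / 2"] by (auto simp: Q_def)
    \<comment> \<open>Bounds \<open>a\<close> at every remainder modulo \<open>k\<close>,
      independently of \<open>n\<close>, so that it disappears after division by
      \<open>n\<close>.\<close>
    define M where "M = (\<Sum>r<k. a r)"
    obtain N :: nat where N: "real M / (e / 2) < real N"
      using reals_Archimedean2 by blast
    have "norm (real (a n) / real n - L) < e" if n: "max 1 N \<le> n" for n
    proof -
      have "n mod k < k" using k by simp
      then have "a (n mod k) \<le> M"
        unfolding M_def by (intro member_le_sum) auto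
      then have "a n \<le> (n div k) * a k + M"
        using multiple[of "n div k" k "n mod k"] by simp
      then have "real (a n) \<le> real (n div k) * real (a k) + real M"
        by (metis of_nat_add of_nat_le_iff of_nat_mult)
      also have "\<dots> \<le> (real n / real k) * real (a k) + real M"
        using of_nat_div_le_of_nat[of n k, where ?'a = real] by (intro add_right_mono mult_right_mono) auto
      finally have "real (a n) / real n \<le> ((real n / real k) * real (a k) + real M) / real n"
        by (rule divide_right_mono) simp
      also have "\<dots> = real (a k) / real k + real M / real n"
        using n by (simp add: add_divide_distrib)
      finally have "real (a n) / real n \<le> real (a k) / real k + real M / real n" .
      moreover have "real M / real n < e / 2"
      proof -
        have "real M / (e / 2) < real n" using N n by linarith
        then show ?thesis using e n by (simp add: field_simps)
      qed
      ultimately have "real (a n) / real n < L + e" using k(2) by linarith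
      moreover have "L \<le> real (a n) / real n" using lower n by simp
      ultimately show ?thesis by simp
    qed
    then show "\<exists>no. \<forall>n\<ge>no. norm (real (a n) / real n - L) < e" by blast
  qed
  then show ?thesis using that lower by blast
qed

lemma covering_exponent_add:
  "covering_exponent V E m s \<Longrightarrow> covering_exponent V E n t \<Longrightarrow> covering_exponent V E (m + n) (s + t)"
  by (auto simp: covering_exponent_def keys_add_nat weight_add intro: add_mono)

lemma covering_exponent_indicator:
  assumes "finite V" "S \<subseteq> V" "\<And>C. vertex_cover V E C \<Longrightarrow> c \<le> card (C \<inter> S)"
  shows "covering_exponent V E c (indicator_monomial S)"
  unfolding covering_exponent_def
proof (intro conjI allI impI)
  have finS: "finite S" using assms(1,2) finite_subset by blast
  then show "Poly_Mapping.keys (indicator_monomial S) \<subseteq> V"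
    using assms(2) by (simp add: keys_indicator_monomial)
  fix C assume C: "vertex_cover V E C"
  then have "finite C"
    using assms(1) finite_subset unfolding vertex_cover_def by blast
  then show "c \<le> weight C (indicator_monomial S)"
    using assms(3)[OF C] by (simp add: weight_indicator_monomial finS)
qed

text \<open>An edge makes every cover nonempty, so the product of all variables has weight at least
  1 on each cover; its powers serve for larger \<open>m\<close>.\<close>

lemma covering_exponent_exists:
  assumes G: "simple_graph V E" and E: "E \<noteq> {}"
  shows "\<exists>t. covering_exponent V E m t"
proof (induction m)
  case 0
  have "covering_exponent V E 0 0" by (simp add: covering_exponent_def)
  then show ?case by blast
next
  case (Suc m)
  have finV: "finite V" using G by (simp add: simple_graph_def)
  have "covering_exponent V E 1 (indicator_monomial V)"
  proof (rule covering_exponent_indicator[OF finV subset_refl])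
    fix C assume C: "vertex_cover V E C"
    then have "C \<inter> V \<noteq> {}" using E unfolding vertex_cover_def by blast
    then show "1 \<le> card (C \<inter> V)"
      using finV by (simp add: Suc_le_eq card_gt_0_iff)
  qed
  then show ?case using covering_exponent_add[of V E m _ 1] Suc by fastforce
qed

lemma covering_degree_attained:
  assumes "simple_graph V E" "E \<noteq> {}"
  obtains t where "covering_exponent V E m t" "weight V t = covering_degree V E m"
  using covering_exponent_exists[OF assms, of m]
    LeastI_ex[of "\<lambda>d. \<exists>t. covering_exponent V E m t \<and> weight V t = d"]
  unfolding covering_degree_def by blast

lemma covering_degree_le: "covering_exponent V E m t \<Longrightarrow> covering_degree V E m \<le> weight V t"
  unfolding covering_degree_def by (rule Least_le) blast

lemma covering_degree_subadditive:
  assumes "simple_graph V E" "E \<noteq> {}"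
  shows "covering_degree V E (m + n) \<le> covering_degree V E m + covering_degree V E n"
proof -
  obtain s where s: "covering_exponent V E m s" "weight V s = covering_degree V E m"
    by (rule covering_degree_attained[OF assms])
  obtain t where t: "covering_exponent V E n t" "weight V t = covering_degree V E n"
    by (rule covering_degree_attained[OF assms])
  show ?thesis
    using covering_degree_le[OF covering_exponent_add[OF s(1) t(1)]] s(2) t(2)
    by (simp add: weight_add)
qed

text \<open>On each side of \<open>i\<close> the parity is fixed, so halving is injective there;
  rounding up beyond \<open>i\<close> keeps the two ranges of values apart. This counts the
  rotations missing a vertex of an odd cycle.\<close>

lemma div_2_eq_imp_eq:
  fixes i x y :: nat
  assumes x: "if x \<le> i then even (i + x) else odd (i + x)"
    and y: "if y \<le> i then even (i + y) else odd (i + y)"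
    and eq: "(if x \<le> i then x div 2 else Suc x div 2) = (if y \<le> i then y div 2 else Suc y div 2)"
  shows "x = y"
proof -
  have above: "i div 2 < Suc z div 2" if "i < z" for z
    using div_le_mono[of "i + 2" "Suc z" 2] that by simp
  have below: "z div 2 \<le> i div 2" if "z \<le> i" for z
    using that by (rule div_le_mono)
  have same: "x \<le> i \<longleftrightarrow> y \<le> i"
    using eq above[of x] above[of y] below[of x] below[of y] by (auto split: if_splits)
  have parity: "even x \<longleftrightarrow> even y"
    using x y same by (cases "x \<le> i") auto
  show ?thesis
  proof (cases "x \<le> i")
    case True
    then show ?thesis using eq same parity
      by (metis even_two_times_div_two odd_two_times_div_two_succ)
  next
    case False
    then have "Suc x div 2 = Suc y div 2" using eq same by simp
    moreover have "even (Suc x) \<longleftrightarrow> even (Suc y)" using parity by simp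
    ultimately have "Suc x = Suc y" by (metis even_two_times_div_two odd_two_times_div_two_succ)
    then show ?thesis by simp
  qed
qed

section \<open>Upper and lower bounds on the Waldschmidt constant\<close>

context
  fixes V :: "'v::linorder set" and E :: "'v set set" and W :: real
  assumes G: "simple_graph V E" and E: "E \<noteq> {}"
  defines "W \<equiv> waldschmidt (mpoly_ring V) (edge_ideal V E :: ('v, 'k::field) mpoly set)"
begin

lemma finite_V: "finite V"
  using G by (simp add: simple_graph_def)

text \<open>Fekete's lemma shows that \<open>lim\<close> denotes a genuine limit. Since this is an
  infimum, a single index already gives an upper bound.\<close>

lemma waldschmidt_limit: "(\<lambda>m. real (covering_degree V E m) / real m) \<longlonglongrightarrow> W"
  and waldschmidt_le: "1 \<le> k \<Longrightarrow> W \<le> real (covering_degree V E k) / real k"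
proof -
  obtain L where L: "(\<lambda>m. real (covering_degree V E m) / real m) \<longlonglongrightarrow> L"
      "\<And>k. 1 \<le> k \<Longrightarrow> L \<le> real (covering_degree V E k) / real k"
    using subadditive_limit[of "covering_degree V E"] covering_degree_subadditive[OF G E] by blast
  have "W = L"
    unfolding W_def waldschmidt_def initial_degree_symbolic_power[OF G] by (rule limI[OF L(1)])
  then show "(\<lambda>m. real (covering_degree V E m) / real m) \<longlonglongrightarrow> W"
    "1 \<le> k \<Longrightarrow> W \<le> real (covering_degree V E k) / real k"
    using L by auto
qed

lemma waldschmidt_upper:
  assumes "S \<subseteq> V" "1 \<le> c" "\<And>C. vertex_cover V E C \<Longrightarrow> c \<le> card (C \<inter> S)"
  shows "W \<le> real (card S) / real c"
proof -
  have "covering_degree V E c \<le> weight V (indicator_monomial S)"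
    by (intro covering_degree_le covering_exponent_indicator finite_V assms)
  also have "\<dots> = card S"
    using assms(1) finite_V finite_subset[OF assms(1)]
    by (simp add: weight_indicator_monomial Int_absorb1)
  finally have "real (covering_degree V E c) / real c \<le> real (card S) / real c"
    by (simp add: divide_right_mono)
  then show ?thesis using waldschmidt_le[OF assms(2)] by linarith
qed

text \<open>Weak duality: complements of independent sets are covers, and adding their constraints
  counts each vertex at most \<open>b\<close> times. Indexing by \<open>J\<close> lets a set occur
  repeatedly.\<close>

lemma waldschmidt_lower:
  assumes J: "finite J" and indep: "\<And>j e. j \<in> J \<Longrightarrow> e \<in> E \<Longrightarrow> \<not> e \<subseteq> A j"
    and b: "0 < b" "\<And>v. v \<in> V \<Longrightarrow> card {j \<in> J. v \<notin> A j} \<le> b"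
  shows "real (card J) / real b \<le> W"
proof (rule LIMSEQ_le_const[OF waldschmidt_limit], intro exI[of _ 1] allI impI)
  fix m :: nat assume m: "1 \<le> m"
  obtain t where t: "covering_exponent V E m t" "weight V t = covering_degree V E m"
    by (rule covering_degree_attained[OF G E])
  have "m \<le> weight (V - A j) t" if "j \<in> J" for j
  proof -
    have "vertex_cover V E (V - A j)"
      unfolding vertex_cover_def
    proof (intro conjI ballI)
      fix e assume e: "e \<in> E"
      then have "e \<subseteq> V" by (auto elim: simple_graph_edgeE[OF G])
      then show "e \<inter> (V - A j) \<noteq> {}" using indep[OF that e] by blast
    qed auto
    then show ?thesis using t(1) by (auto simp: covering_exponent_def)
  qed
  then have "card J * m \<le> (\<Sum>j\<in>J. weight (V - A j) t)"
    using sum_mono[of J "\<lambda>_. m"] by simp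
  also have "\<dots> = (\<Sum>j\<in>J. \<Sum>v\<in>V. if v \<notin> A j then Poly_Mapping.lookup t v else 0)"
    unfolding weight_def using finite_V
    by (intro sum.cong[OF refl, of J]) (simp add: set_diff_eq sum.inter_filter)
  \<comment> \<open>Double counting: the sum is regrouped by vertices.\<close>
  also have "\<dots> = (\<Sum>v\<in>V. \<Sum>j\<in>J. if v \<notin> A j then Poly_Mapping.lookup t v else 0)"
    by (rule sum.swap)
  also have "\<dots> = (\<Sum>v\<in>V. card {j \<in> J. v \<notin> A j} * Poly_Mapping.lookup t v)"
    using J by (intro sum.cong refl) (simp flip: sum.inter_filter)
  also have "\<dots> \<le> (\<Sum>v\<in>V. b * Poly_Mapping.lookup t v)"
    using b(2) by (intro sum_mono mult_right_mono) auto
  also have "\<dots> = b * covering_degree V E m"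
    by (simp add: weight_def sum_distrib_left flip: t(2))
  finally have "real (card J) * real m \<le> real b * real (covering_degree V E m)"
    by (metis of_nat_le_iff of_nat_mult)
  then show "real (card J) / real b \<le> real (covering_degree V E m) / real m"
    using m b(1) by (simp add: field_simps)
qed

text \<open>A covered vertex is missed by at most \<open>card J - 1\<close> of the sets. An edge
  does not fit into one independent set, which keeps the denominator positive.\<close>

lemma waldschmidt_ge_of_independent_covering:
  assumes J: "finite J" and indep: "\<And>j e. j \<in> J \<Longrightarrow> e \<in> E \<Longrightarrow> \<not> e \<subseteq> A j"
    and cov: "\<And>v. v \<in> V \<Longrightarrow> \<exists>j\<in>J. v \<in> A j"
  shows "2 \<le> card J" and "real (card J) / (real (card J) - 1) \<le> W"
proof -
  show J2: "2 \<le> card J"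
  proof (rule ccontr)
    assume "\<not> 2 \<le> card J"
    then have "card J \<le> Suc 0" by simp
    then have eq: "i = j" if "i \<in> J" "j \<in> J" for i j
      using J that by (simp add: card_le_Suc0_iff_eq)
    obtain e where e: "e \<in> E" using E by blast
    then obtain x y where xy: "e = {x, y}" "x \<noteq> y" "x \<in> V" "y \<in> V"
      by (rule simple_graph_edgeE[OF G])
    then obtain j where "j \<in> J" "x \<in> A j" "y \<in> A j"
      using cov[of x] cov[of y] eq by blast
    then show False using indep[of j e] e xy by simp
  qed
  have "card {j \<in> J. v \<notin> A j} \<le> card J - 1" if v: "v \<in> V" for v
  proof -
    obtain j where j: "j \<in> J" "v \<in> A j" using cov[OF v] by blast
    then have "card {j \<in> J. v \<notin> A j} \<le> card (J - {j})"
      using J by (intro card_mono) auto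
    then show ?thesis using j J by simp
  qed
  then have "real (card J) / real (card J - 1) \<le> W"
    using J2 by (intro waldschmidt_lower[OF J indep]) auto
  then show "real (card J) / (real (card J) - 1) \<le> W"
    using J2 by (simp add: of_nat_diff)
qed

text \<open>A cover misses at most one vertex of a clique, since two missed vertices would span an
  uncovered edge.\<close>

lemma waldschmidt_le_clique:
  assumes S: "S \<subseteq> V" "clique S E" "2 \<le> card S"
  shows "W \<le> real (card S) / (real (card S) - 1)"
proof -
  have finS: "finite S" using S(1) finite_V finite_subset by blast
  have "card S - 1 \<le> card (C \<inter> S)" if C: "vertex_cover V E C" for C
  proof -
    have "x = y" if "x \<in> S - C" "y \<in> S - C" for x y
    proof (rule ccontr)
      assume "x \<noteq> y"
      then have "{x, y} \<in> E" using S(2) that unfolding clique_def by blast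
      then show False using vertex_cover_edgeD[OF C] that by blast
    qed
    then have "card (S - C) \<le> 1"
      using finS by (simp add: card_le_Suc0_iff_eq)
    moreover have "card S = card (S \<inter> C) + card (S - C)"
      using finS by (rule card_Int_Diff)
    ultimately show ?thesis by (simp add: Int_commute)
  qed
  then have "W \<le> real (card S) / real (card S - 1)"
    using S by (intro waldschmidt_upper) auto
  then show ?thesis using S(3) by (simp add: of_nat_diff)
qed

section \<open>Graphs with equal chromatic and clique number\<close>

lemma chromatic_number_colouring:
  obtains c where "colouring V E (chromatic_number V E) c"
proof -
  \<comment> \<open>Edges join distinct vertices, so an injective numbering is a colouring and
    witnesses the \<open>LEAST\<close>.\<close>
  obtain f :: "'v \<Rightarrow> nat" and n where f: "f ` V = {i. i < n}" "inj_on f V"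
    using finite_imp_inj_to_nat_seg[OF finite_V] by blast
  have "f u \<noteq> f v" if "u \<in> V" "v \<in> V" "{u, v} \<in> E" for u v
  proof -
    have "{u, v} \<in> [V]\<^bsup>2\<^esup>" using G that(3) unfolding simple_graph_def by blast
    then show ?thesis using f(2) that by (simp add: inj_on_eq_iff)
  qed
  then have "colouring V E n f"
    using f(1) by (auto simp: colouring_def)
  then have "\<exists>c. colouring V E (chromatic_number V E) c"
    unfolding chromatic_number_def
    by (intro LeastI_ex[of "\<lambda>k. \<exists>c. colouring V E k c"]) blast
  then show ?thesis using that by blast
qed

lemma clique_number_clique:
  obtains S where "S \<subseteq> V" "clique S E" "card S = clique_number V E"
proof -
  have "clique_number V E \<in> card ` {A. A \<subseteq> V \<and> clique A E}"
    unfolding clique_number_def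
  proof (rule Max_in)
    show "finite (card ` {A. A \<subseteq> V \<and> clique A E})"
      using finite_V by (auto intro: finite_subset[of _ "Pow V"])
    have "clique {} E" by (simp add: clique_def)
    then show "card ` {A. A \<subseteq> V \<and> clique A E} \<noteq> {}" by blast
  qed
  then show ?thesis using that by auto
qed

text \<open>The colour classes of an optimal colouring bound from below, a largest clique from
  above; the assumption makes the bounds meet.\<close>

lemma waldschmidt_chromatic_eq_clique:
  assumes "chromatic_number V E = clique_number V E"
  shows "W = real (chromatic_number V E) / (real (chromatic_number V E) - 1)"
proof -
  let ?k = "chromatic_number V E"
  obtain c where c: "colouring V E ?k c" by (rule chromatic_number_colouring)
  define A where "A = (\<lambda>j. {v \<in> V. c v = j})"
  have indep: "\<not> e \<subseteq> A j" if e: "e \<in> E" for e j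
  proof -
    obtain x y where xy: "e = {x, y}" "x \<noteq> y" "x \<in> V" "y \<in> V"
      using simple_graph_edgeE[OF G e] .
    then have "c x \<noteq> c y" using c e unfolding colouring_def by blast
    then show ?thesis using xy by (auto simp: A_def)
  qed
  have cov: "\<exists>j\<in>{..<?k}. v \<in> A j" if "v \<in> V" for v
    using c that by (auto simp: colouring_def A_def)
  have k2: "2 \<le> ?k" and ge: "real ?k / (real ?k - 1) \<le> W"
    using waldschmidt_ge_of_independent_covering[of "{..<?k}" A] indep cov by auto
  obtain S where "S \<subseteq> V" "clique S E" "card S = clique_number V E"
    by (rule clique_number_clique)
  then have "W \<le> real ?k / (real ?k - 1)"
    using waldschmidt_le_clique[of S] assms k2 by simp
  then show ?thesis using ge by linarith
qed

section \<open>Multipartite graphs\<close>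

lemma waldschmidt_multipartition:
  assumes P: "multipartition V E k P"
  shows "2 \<le> k" and "real k / (real k - 1) \<le> W"
proof -
  have part: "partition_on V P" and k: "card P = k" and ind: "\<And>A e. A \<in> P \<Longrightarrow> e \<in> E \<Longrightarrow> \<not> e \<subseteq> A"
    using P by (auto simp: multipartition_def)
  have fin: "finite P" by (rule finite_elements[OF finite_V part])
  have "\<exists>A\<in>P. v \<in> A" if "v \<in> V" for v
    using that partition_onD1[OF part] by blast
  then show "2 \<le> k" "real k / (real k - 1) \<le> W"
    using waldschmidt_ge_of_independent_covering[OF fin, of "\<lambda>A. A"] ind k by auto
qed

text \<open>Choosing one vertex from each of the nonempty parts gives a clique of size
  \<open>k\<close>, which matches the lower bound from the parts.\<close>

lemma waldschmidt_complete_multipartite: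
  assumes "complete_k_partite k V E"
  shows "W = real k / (real k - 1)"
proof -
  obtain P where P: "multipartition V E k P"
    and EP: "E = {{u, v} | u v. \<exists>A\<in>P. \<exists>B\<in>P. A \<noteq> B \<and> u \<in> A \<and> v \<in> B}"
    using assms by (auto simp: complete_k_partite_def)
  have part: "partition_on V P" and k: "card P = k"
    using P by (auto simp: multipartition_def)
  define f where "f = (\<lambda>A :: 'v set. SOME v. v \<in> A)"
  have f: "f A \<in> A" if "A \<in> P" for A
    using partition_onD3[OF part] that unfolding f_def by (metis some_in_eq)
  have "inj_on f P"
    by (rule inj_onI) (metis f disjointD partition_onD2[OF part] disjoint_iff)
  then have card: "card (f ` P) = k"
    using k by (simp add: card_image)
  have "clique (f ` P) E"
    unfolding clique_def
  proof (intro ballI impI)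
    fix u v assume "u \<in> f ` P" "v \<in> f ` P" "u \<noteq> v"
    then obtain A B where "A \<in> P" "B \<in> P" "A \<noteq> B" "u = f A" "v = f B" by blast
    then show "{u, v} \<in> E"
      unfolding EP using f by blast
  qed
  moreover have "f ` P \<subseteq> V"
    using f partition_onD1[OF part] by blast
  ultimately have "W \<le> real k / (real k - 1)"
    using waldschmidt_le_clique[of "f ` P"] waldschmidt_multipartition(1)[OF P] card by simp
  then show ?thesis
    using waldschmidt_multipartition(2)[OF P] by linarith
qed

text \<open>Any edge is a clique of size 2 and supplies the upper bound.\<close>

lemma waldschmidt_bipartite:
  assumes "bipartite V E"
  shows "W = 2"
proof -
  obtain P where "multipartition V E 2 P" using assms by (auto simp: k_partite_def)
  then have "2 \<le> W" using waldschmidt_multipartition(2) by fastforce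
  obtain e where e: "e \<in> E" using E by blast
  obtain x y where xy: "e = {x, y}" "x \<noteq> y" "x \<in> V" "y \<in> V"
    using simple_graph_edgeE[OF G e] .
  then have "clique e E" using e by (auto simp: clique_def insert_commute)
  then have "W \<le> 2" using waldschmidt_le_clique[of e] xy by simp
  then show ?thesis using \<open>2 \<le> W\<close> by linarith
qed

text \<open>Each vertex is missed by at most \<open>n + 1\<close> of the \<open>2 * n + 1\<close>
  rotated independent sets, and each cover has at least \<open>n + 1\<close> vertices.\<close>

lemma waldschmidt_odd_cycle:
  assumes "cycle_graph (2 * n + 1) V E"
  shows "W = (2 * real n + 1) / (real n + 1)"
proof -
  let ?m = "2 * n + 1"
  obtain f where bij: "bij_betw f {..<?m} V" and EF: "E = {{f i, f (Suc i mod ?m)} | i. i < ?m}"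
    using assms by (auto simp: cycle_graph_def)
  have inj: "f i = f j \<longleftrightarrow> i = j" if "i < ?m" "j < ?m" for i j
    using bij that by (auto simp: bij_betw_def inj_on_eq_iff)
  have V: "V = f ` {..<?m}" using bij by (simp add: bij_betw_def)
  have cardV: "card V = ?m" using bij_betw_same_card[OF bij] by simp
  \<comment> \<open>Going around the cycle from vertex \<open>j\<close>, take every second vertex, starting with the
    successor of \<open>j\<close>.\<close>
  define D where "D = (\<lambda>j. {i. i < ?m \<and> (j < i \<and> odd (i - j) \<or> i < j \<and> even (j - i))})"
  have indep: "\<not> e \<subseteq> f ` D j" if j: "j \<in> {..<?m}" and e: "e \<in> E" for j e
  proof
    assume sub: "e \<subseteq> f ` D j"
    obtain i where i: "i < ?m" "e = {f i, f (Suc i mod ?m)}" using e EF by blast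
    have mem: "k \<in> D j" if k: "k < ?m" "f k \<in> f ` D j" for k
    proof -
      obtain d where d: "d \<in> D j" "f k = f d" using k(2) by blast
      then have "d < ?m" by (simp add: D_def)
      then show ?thesis using d inj[OF k(1)] by simp
    qed
    have "i \<in> D j" "Suc i mod ?m \<in> D j"
      using sub i mem[of i] mem[of "Suc i mod ?m"] by simp_all
    then have i_in: "j < i \<and> odd (i - j) \<or> i < j \<and> even (j - i)"
      and Suc_in: "j < Suc i mod ?m \<and> odd (Suc i mod ?m - j) \<or> Suc i mod ?m < j \<and> even (j - Suc i mod ?m)"
      by (simp_all add: D_def)
    show False
    proof (cases "Suc i = ?m")
      \<comment> \<open>The closing edge from \<open>2 * n\<close> to 0: membership of its ends
        would force \<open>j\<close> to be odd and even at once.\<close>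
      case True
      then have "Suc i mod ?m = 0" "i = 2 * n" by simp_all
      then show ?thesis using i_in Suc_in j by auto
    next
      case False
      then have "Suc i mod ?m = Suc i" using i(1) by simp
      then show ?thesis using i_in Suc_in by (auto simp: Suc_diff_le)
    qed
  qed
  have count: "card {j \<in> {..<?m}. v \<notin> f ` D j} \<le> n + 1" if v: "v \<in> V" for v
  proof -
    obtain i where i: "i < ?m" "v = f i" using v V by blast
    have sub: "{j \<in> {..<?m}. v \<notin> f ` D j} \<subseteq> {j. j < ?m \<and> i \<notin> D j}"
      using i by auto
    \<comment> \<open>An injection of the rotations that miss vertex \<open>i\<close> into the
      numbers from 0 to \<open>n\<close>.\<close>
    let ?g = "\<lambda>j. if j \<le> i then j div 2 else Suc j div 2"
    have "inj_on ?g {j. j < ?m \<and> i \<notin> D j}"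
    proof (rule inj_onI)
      have parity: "if x \<le> i then even (i + x) else odd (i + x)" if "i \<notin> D x" for x
        using that i(1) by (auto simp: D_def)
      fix x y assume "x \<in> {j. j < ?m \<and> i \<notin> D j}" "y \<in> {j. j < ?m \<and> i \<notin> D j}" "?g x = ?g y"
      then show "x = y"
        by (intro div_2_eq_imp_eq[of x i y] parity) auto
    qed
    moreover have "?g ` {j. j < ?m \<and> i \<notin> D j} \<subseteq> {..n}"
      using i by auto
    ultimately have "card {j. j < ?m \<and> i \<notin> D j} \<le> card {..n}"
      by (rule card_inj_on_le) simp
    moreover have "card {j \<in> {..<?m}. v \<notin> f ` D j} \<le> card {j. j < ?m \<and> i \<notin> D j}"
      by (rule card_mono[OF _ sub]) simp
    ultimately show ?thesis by simp
  qed
  have "real (card {..<?m}) / real (n + 1) \<le> W"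
    by (rule waldschmidt_lower[OF _ indep _ count]) auto
  moreover have "n + 1 \<le> card (C \<inter> V)" if C: "vertex_cover V E C" for C
  proof -
    \<comment> \<open>Adding the edge constraints around the cycle counts each cover vertex twice,
      so twice the size is at least \<open>2 * n + 1\<close>; integrality rounds the size up to
      \<open>n + 1\<close>.\<close>
    define g where "g = (\<lambda>i. if f i \<in> C then 1 else 0 :: nat)"
    have "1 \<le> g i + g (Suc i mod ?m)" if "i < ?m" for i
    proof -
      have "{f i, f (Suc i mod ?m)} \<in> E" using that EF by blast
      then have "{f i, f (Suc i mod ?m)} \<inter> C \<noteq> {}"
        using C unfolding vertex_cover_def by blast
      then show ?thesis by (auto simp: g_def)
    qed
    then have "(\<Sum>i<?m. 1) \<le> (\<Sum>i<?m. g i + g (Suc i mod ?m))"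
      by (intro sum_mono) auto
    moreover have "(\<Sum>i<?m. g (Suc i mod ?m)) = (\<Sum>i<?m. g i)"
    proof -
      have "(\<Sum>i<Suc (2 * n). g (Suc i mod Suc (2 * n))) = (\<Sum>i<2 * n. g (Suc i)) + g 0"
        by (simp add: sum.lessThan_Suc)
      also have "\<dots> = (\<Sum>i<Suc (2 * n). g i)"
        by (simp only: sum.lessThan_Suc_shift add.commute)
      finally show ?thesis by simp
    qed
    moreover have "(\<Sum>i<?m. g i) = card (C \<inter> V)"
    proof -
      have "(\<Sum>i<?m. g i) = (\<Sum>v\<in>V. if v \<in> C then 1 else 0)"
        unfolding g_def by (rule sum.reindex_bij_betw[OF bij])
      then show ?thesis
        using finite_V by (simp add: sum.If_cases Int_commute)
    qed
    ultimately show ?thesis by (simp add: sum.distrib)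
  qed
  then have "W \<le> real (card V) / real (n + 1)"
    by (intro waldschmidt_upper) auto
  ultimately show ?thesis
    using cardV by (simp add: add_ac)
qed

text \<open>The cycle edges are independent in the complement, and each vertex lies on two of them.
  Vertices outside a cover are pairwise adjacent in the cycle, so there are at most two.\<close>

lemma waldschmidt_odd_cycle_complement:
  assumes "cycle_complement_graph (2 * n + 1) V E"
  shows "W = (2 * real n + 1) / (2 * real n - 1)"
proof -
  let ?m = "2 * n + 1"
  obtain F where F: "cycle_graph ?m V F" and EF: "E = complement_edges V F"
    using assms by (auto simp: cycle_complement_graph_def)
  obtain f where m3: "3 \<le> ?m" and bij: "bij_betw f {..<?m} V"
    and FF: "F = {{f i, f (Suc i mod ?m)} | i. i < ?m}"
    using F by (auto simp: cycle_graph_def)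
  have inj: "f i = f j \<longleftrightarrow> i = j" if "i < ?m" "j < ?m" for i j
    using bij that by (auto simp: bij_betw_def inj_on_eq_iff)
  have V: "V = f ` {..<?m}" using bij by (simp add: bij_betw_def)
  have cardV: "card V = ?m" using bij_betw_same_card[OF bij] by simp
  \<comment> \<open>Ordering the indices removes the modulus: cycle edges join consecutive indices,
    except for the closing one.\<close>
  have F_iff: "{f i, f j} \<in> F \<longleftrightarrow> j = Suc i \<or> (i = 0 \<and> j = 2 * n)" if ij: "i < j" "j < ?m" for i j
  proof
    assume "{f i, f j} \<in> F"
    then obtain k where k: "k < ?m" "{f i, f j} = {f k, f (Suc k mod ?m)}"
      using FF by blast
    then have "i = k \<and> j = Suc k mod ?m \<or> i = Suc k mod ?m \<and> j = k"
      using ij inj by (auto simp: doubleton_eq_iff)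
    then show "j = Suc i \<or> (i = 0 \<and> j = 2 * n)"
      using ij k(1) by (cases "Suc k = ?m") auto
  next
    assume "j = Suc i \<or> (i = 0 \<and> j = 2 * n)"
    then show "{f i, f j} \<in> F"
    proof
      assume "j = Suc i"
      then show ?thesis using ij FF by (auto intro!: exI[of _ i])
    next
      assume "i = 0 \<and> j = 2 * n"
      then show ?thesis using ij FF by (auto intro!: exI[of _ j])
    qed
  qed
  \<comment> \<open>For \<open>n = 1\<close> the cycle is a triangle, whose complement has no
    edge.\<close>
  have n2: "2 \<le> n"
  proof (rule ccontr)
    assume "\<not> 2 \<le> n"
    then have n1: "n = 1" using m3 by linarith
    obtain e where e: "e \<in> E" using E by blast
    obtain x y where xy: "e = {x, y}" "x \<noteq> y" "x \<in> V" "y \<in> V"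
      using simple_graph_edgeE[OF G e] .
    obtain i j where ij: "i < ?m" "j < ?m" "x = f i" "y = f j" using xy V by blast
    have "i < j \<or> j < i" using xy(2) ij by (metis nat_neq_iff)
    then have "e \<in> F"
      using F_iff[of i j] F_iff[of j i] ij n1 xy(1) by (auto simp: insert_commute)
    then show False using e EF by (simp add: complement_edges_def)
  qed
  let ?A = "\<lambda>j. {f j, f (Suc j mod ?m)}"
  have indep: "\<not> e \<subseteq> ?A j" if j: "j \<in> {..<?m}" and e: "e \<in> E" for j e
  proof
    assume "e \<subseteq> ?A j"
    moreover obtain x y where "e = {x, y}" "x \<noteq> y" "x \<in> V" "y \<in> V"
      using simple_graph_edgeE[OF G e] .
    ultimately have "e = ?A j" by auto
    then have "e \<in> F" using j FF by blast
    then show False using e EF by (simp add: complement_edges_def)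
  qed
  have count: "card {j \<in> {..<?m}. v \<notin> ?A j} \<le> 2 * n - 1" if v: "v \<in> V" for v
  proof -
    obtain i where i: "i < ?m" "v = f i" using v V by blast
    \<comment> \<open>The cyclic predecessor of \<open>i\<close>; the cycle edges through
      \<open>v\<close> are exactly those starting at \<open>i\<close> and at
      \<open>p\<close>.\<close>
    define p where "p = (if i = 0 then 2 * n else i - 1)"
    have p: "p < ?m" "p \<noteq> i" "Suc p mod ?m = i"
      using i n2 by (auto simp: p_def)
    have "{j \<in> {..<?m}. v \<notin> ?A j} \<subseteq> {..<?m} - {i, p}"
      using i p by auto
    then have "card {j \<in> {..<?m}. v \<notin> ?A j} \<le> card ({..<?m} - {i, p})"
      by (intro card_mono) auto
    also have "\<dots> = 2 * n - 1"
      using i p by (simp add: card_Diff_subset)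
    finally show ?thesis .
  qed
  have "real (card {..<?m}) / real (2 * n - 1) \<le> W"
    using n2 by (intro waldschmidt_lower[OF _ indep _ count]) auto
  moreover have "2 * n - 1 \<le> card (C \<inter> V)" if C: "vertex_cover V E C" for C
  proof -
    define B where "B = {i. i < ?m \<and> f i \<notin> C}"
    have adj: "j = Suc i \<or> (i = 0 \<and> j = 2 * n)" if ij: "i \<in> B" "j \<in> B" "i < j" for i j
    proof -
      have ij': "i < ?m" "j < ?m" "f i \<notin> C" "f j \<notin> C" using ij(1,2) by (simp_all add: B_def)
      have "{f i, f j} \<notin> E" using vertex_cover_edgeD[OF C] ij' by blast
      moreover have "{f i, f j} \<in> [V]\<^bsup>2\<^esup>"
        using ij' ij(3) inj V by auto
      ultimately have "{f i, f j} \<in> F" using EF by (simp add: complement_edges_def)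
      then show ?thesis using F_iff ij(3) ij'(2) by blast
    qed
    have "card B \<le> 2"
    proof (rule ccontr)
      assume "\<not> card B \<le> 2"
      moreover have "finite B" by (simp add: B_def)
      ultimately obtain T where T: "T \<subseteq> B" "card T = 3"
        using obtain_subset_with_card_n[of 3 B] by (metis not_less_eq_eq numeral_2_eq_2 numeral_3_eq_3)
      then obtain x y z where "T = {x, y, z}" "x \<noteq> y" "y \<noteq> z" "x \<noteq> z"
        by (auto simp: card_3_iff)
      then obtain a b c where abc: "a \<in> B" "b \<in> B" "c \<in> B" "a < b" "b < c"
        using T(1) by (metis insertI1 insertI2 linorder_neqE_nat subset_iff)
      have "c < ?m" using abc by (simp add: B_def)
      \<comment> \<open>The pairs \<open>a b\<close> and \<open>b c\<close> must be consecutive, so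
        \<open>c = a + 2\<close>; adjacency of \<open>a\<close> and \<open>c\<close> then forces
        \<open>n = 1\<close>.\<close>
      then show False
        using adj[of a b] adj[of b c] adj[of a c] abc n2 by auto
    qed
    moreover have "card (V - C) = card B"
    proof -
      have "bij_betw f B (V - C)"
        unfolding bij_betw_def
      proof
        show "inj_on f B" using inj by (auto simp: inj_on_def B_def)
        show "f ` B = V - C" unfolding V B_def by auto
      qed
      then show ?thesis by (simp add: bij_betw_same_card)
    qed
    moreover have "card V = card (V \<inter> C) + card (V - C)"
      using finite_V by (rule card_Int_Diff)
    ultimately show ?thesis using cardV by (simp add: Int_commute)
  qed
  then have "W \<le> real (card V) / real (2 * n - 1)"
    using n2 by (intro waldschmidt_upper) auto
  ultimately show ?thesis
    using cardV n2 by (simp add: of_nat_diff)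
qed

end

lemma induced_edges_self:
  assumes "simple_graph V E"
  shows "induced_edges E V = E"
  using assms by (auto simp: induced_edges_def elim: simple_graph_edgeE)

theorem theorem6p7:
  fixes V :: "'v::linorder set" and E :: "'v set set"
    and I :: "('v, 'k::alg_closed_field) mpoly set"
  assumes graph: "simple_graph V E"
    and edge: "E \<noteq> {}"
    and I: "I = edge_ideal V E"
  shows
    "(chromatic_number V E = clique_number V E \<longrightarrow>
        waldschmidt (mpoly_ring V) I =
          real (chromatic_number V E) / (real (chromatic_number V E) - 1)) \<and>
     (perfect_graph V E \<longrightarrow>
        waldschmidt (mpoly_ring V) I =
          real (chromatic_number V E) / (real (chromatic_number V E) - 1)) \<and>
     (\<forall>k. k_partite k V E \<longrightarrow> waldschmidt (mpoly_ring V) I \<ge> real k / (real k - 1)) \<and>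
     (\<forall>k. complete_k_partite k V E \<longrightarrow> waldschmidt (mpoly_ring V) I = real k / (real k - 1)) \<and>
     (bipartite V E \<longrightarrow> waldschmidt (mpoly_ring V) I = 2) \<and>
     (\<forall>n. cycle_graph (2 * n + 1) V E \<longrightarrow>
        waldschmidt (mpoly_ring V) I = (2 * real n + 1) / (real n + 1)) \<and>
     (\<forall>n. cycle_complement_graph (2 * n + 1) V E \<longrightarrow>
        waldschmidt (mpoly_ring V) I = (2 * real n + 1) / (2 * real n - 1))"
proof -
  note hyps = graph edge
  \<comment> \<open>Perfectness is used only for the full vertex set, which induces the graph
    itself.\<close>
  have perfect: "chromatic_number V E = clique_number V E" if "perfect_graph V E"
    using that induced_edges_self[OF graph] by (metis perfect_graph_def subset_refl)
  show ?thesis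
    unfolding I
    using waldschmidt_chromatic_eq_clique[OF hyps, where ?'k = 'k] perfect
      waldschmidt_multipartition(2)[OF hyps, where ?'k = 'k]
      waldschmidt_complete_multipartite[OF hyps, where ?'k = 'k]
      waldschmidt_bipartite[OF hyps, where ?'k = 'k]
      waldschmidt_odd_cycle[OF hyps, where ?'k = 'k]
      waldschmidt_odd_cycle_complement[OF hyps, where ?'k = 'k]
    by (simp add: k_partite_def) blast
qed

end
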